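(* The following hold for abelian $1$-factorizations of the complete multipartite graph $K_{m\times n}$. (1) If $m=2^v d$ and $n=2d'$, where $d$ and $d'$ are odd positive integers and $v\ge 2$ is an integer, then an abelian $1$-factorization of $K_{m\times n}$ exists. (2) If $m=p$ and $n=2$, where $p$ is a prime with $p\equiv 1 \pmod 4$, then an abelian $1$-factorization of $K_{m\times n}$ does not exist. (3) If $m=p^v$ and $n=2$, where $p$ is a prime with $p\equiv 1\pmod 4$ and $v\ge 2$ is an integer, then an abelian $1$-factorization of $K_{m\times n}$ exists. (4) If $m\equiv 3\pmod 4$ and $n=2d$, where $d$ is an odd positive integer, then an abelian $1$-factorization of $K_{m\times n}$ does not exist.
   Context: $K_{m\times n}$ denotes the complete multipartite graph with $m$ parts, each consisting of $n$ vertices: two vertices are adjacent if and only if they lie in different parts. A $1$-factor of a graph is a spanning subgraph in which all vertices have degree $1$ (a perfect matching). A $1$-factorization of a graph $\Gamma$ is a decomposition of $\Gamma$ as a union of pairwise edge-disjoint $1$-factors. An automorphism group of a $1$-factorization is a group of permutations of the vertices of $\Gamma$ that maps factors of the factorization to factors of the factorization. An action on the vertices is sharply transitive if for any two vertices $x,y$ there is exactly one group element mapping $x$ to $y$. An abelian $1$-factorization of $K_{m\times n}$ is a $1$-factorization of $K_{m\times n}$ admitting an abelian automorphism group whose action on the vertex set is sharply transitive. *)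

theory Defs
  imports "HOL-Algebra.Bij" "HOL-Number_Theory.Cong"
begin

text \<open>Simple graphs are pairs of a vertex set and a set of edges, each edge being a
  two-element set of vertices.\<close>

type_synonym 'a graph = "'a set \<times> 'a set set"

text \<open>The vertex \<open>(i, j)\<close> is the \<open>j\<close>-th vertex of the \<open>i\<close>-th part.\<close>

definition complete_multipartite :: "nat \<Rightarrow> nat \<Rightarrow> (nat \<times> nat) graph" where
  "complete_multipartite m n =
     (let V = {..<m} \<times> {..<n} in (V, {{x, y} | x y. x \<in> V \<and> y \<in> V \<and> fst x \<noteq> fst y}))"

definition degree :: "'a set set \<Rightarrow> 'a \<Rightarrow> nat" where
  "degree E x = card {e \<in> E. x \<in> e}"

text \<open>A spanning subgraph has all vertices of the graph, so it is given by its edge set.\<close>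

definition one_factor :: "'a graph \<Rightarrow> 'a set set \<Rightarrow> bool" where
  "one_factor \<Gamma> F \<longleftrightarrow> F \<subseteq> snd \<Gamma> \<and> (\<forall>x \<in> fst \<Gamma>. degree F x = 1)"

definition one_factorization :: "'a graph \<Rightarrow> 'a set set set \<Rightarrow> bool" where
  "one_factorization \<Gamma> \<F> \<longleftrightarrow>
     (\<forall>F \<in> \<F>. one_factor \<Gamma> F) \<and> pairwise disjnt \<F> \<and> \<Union>\<F> = snd \<Gamma>"

text \<open>Every edge lies in some factor, so a permutation of the vertices that maps
  factors to factors is automatically an automorphism of the (finite) graph.\<close>

definition automorphism_group_of ::
    "'a graph \<Rightarrow> 'a set set set \<Rightarrow> ('a \<Rightarrow> 'a) set \<Rightarrow> bool" where
  "automorphism_group_of \<Gamma> \<F> G \<longleftrightarrow>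
     subgroup G (BijGroup (fst \<Gamma>)) \<and> (\<forall>g \<in> G. \<forall>F \<in> \<F>. (\<lambda>e. g ` e) ` F \<in> \<F>)"

definition sharply_transitive_on :: "'a set \<Rightarrow> ('a \<Rightarrow> 'a) set \<Rightarrow> bool" where
  "sharply_transitive_on V G \<longleftrightarrow> (\<forall>x \<in> V. \<forall>y \<in> V. \<exists>!g. g \<in> G \<and> g x = y)"

definition abelian_one_factorization :: "'a graph \<Rightarrow> 'a set set set \<Rightarrow> bool" where
  "abelian_one_factorization \<Gamma> \<F> \<longleftrightarrow>
     one_factorization \<Gamma> \<F> \<and>
     (\<exists>G. automorphism_group_of \<Gamma> \<F> G \<and>
          comm_group ((BijGroup (fst \<Gamma>))\<lparr>carrier := G\<rparr>) \<and>
          sharply_transitive_on (fst \<Gamma>) G)"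

end

theory Submission
  imports
    Defs
    Complex_Main
    "HOL-Algebra.Coset"
    "HOL-Library.Disjoint_Sets"
    "HOL-Library.Function_Algebras"
    "HOL-Library.Product_Plus"
    "HOL-Library.Z2"
begin

text \<open>
  All four statements are about an abelian group \<open>G\<close> acting regularly on the vertices. Identifying
  the vertices with \<open>G\<close>, the parts become the cosets of a subgroup \<open>H\<close> of order \<open>n\<close>, and two vertices
  are adjacent iff their difference is not in \<open>H\<close>.

  \<^bold>\<open>Existence.\<close> A translation-invariant one-factorization is determined by representatives of its
  orbits of factors, and these have to use every difference outside \<open>H\<close> exactly once in a
  suitable sense (\<open>abelian_one_factorization_from_starters\<close>). A difference outside some
  subgroup of index two needs no work, since its edges form a matching or a union of even cycles on
  which one can alternate consistently. The remaining differences are those in \<open>2 G\<close>.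

  If \<open>m\<close> is even and \<open>n\<close> is twice an odd number, take for \<open>G\<close> an elementary abelian
  2-group times a group \<open>P\<close> of odd order. Then \<open>2 G = P\<close>, and a single factor built from the pairs
  \<open>{x, - x}\<close> in \<open>P\<close> realizes all differences in question
  (\<open>abelian_one_factorization_elementary_times_odd\<close>).

  If \<open>n = 2\<close> and \<open>m\<close> is odd, then \<open>G\<close> is a group of order two times a group of odd order, and \<open>H\<close>
  contains the only involution. Each factor must then contain edges between the two cosets of \<open>2 G\<close>,
  and the supply of such edges is tight. For a product of two groups whose orders are
  1 modulo 4, and bigger than 1, it is sufficient
  (\<open>abelian_one_factorization_two_split_odd_groups\<close>). A prime power \<open>p ^ v\<close> with \<open>v \<ge> 2\<close> and
  \<open>p\<close> congruent to 1 modulo 4 is treated as \<open>p * p ^ (v - 1)\<close>.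

  \<^bold>\<open>Nonexistence.\<close> Let \<open>n = 2 d\<close> with \<open>m\<close> and \<open>d\<close> odd. Then \<open>H\<close> contains an involution \<open>j\<close>, which fixes
  every part, and no factor is fixed by \<open>j\<close> (\<open>act_j_neq\<close>). Let \<open>V0\<close> contain one vertex from each orbit
  of \<open>j\<close>. Grouping the edges inside \<open>V0\<close> by factors, and the factors into pairs exchanged by \<open>j\<close>, shows
  that the number of ordered adjacent pairs in \<open>V0\<close>, which is \<open>m d (m d - d)\<close>, is divisible by four
  (\<open>four_dvd\<close>). This fails for \<open>m\<close> congruent to 3 modulo 4. For \<open>m = p\<close> prime and \<open>n = 2\<close>
  there are too few factors for regular orbits, so that all stabilizers have order \<open>p\<close>,
  and a group of order \<open>2 p\<close> does not have enough subgroups of order \<open>p\<close> for that.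
\<close>

section \<open>One-factorizations invariant under an abelian group\<close>

definition add_subgroup :: "'a::ab_group_add set \<Rightarrow> bool" where
  "add_subgroup S \<longleftrightarrow> 0 \<in> S \<and> (\<forall>x\<in>S. \<forall>y\<in>S. x - y \<in> S)"

lemma add_subgroup_zero: "add_subgroup S \<Longrightarrow> 0 \<in> S"
  by (simp add: add_subgroup_def)

lemma add_subgroup_diff: "add_subgroup S \<Longrightarrow> x \<in> S \<Longrightarrow> y \<in> S \<Longrightarrow> x - y \<in> S"
  by (simp add: add_subgroup_def)

lemma add_subgroup_uminus: "add_subgroup S \<Longrightarrow> x \<in> S \<Longrightarrow> - x \<in> S"
  using add_subgroup_diff[of S 0 x] add_subgroup_zero[of S] by simp

lemma add_subgroup_add: "add_subgroup S \<Longrightarrow> x \<in> S \<Longrightarrow> y \<in> S \<Longrightarrow> x + y \<in> S"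
  using add_subgroup_diff[of S x "- y"] add_subgroup_uminus[of S y] by simp

lemmas add_subgroup_closed =
  add_subgroup_zero add_subgroup_diff add_subgroup_uminus add_subgroup_add

text \<open>Numbering the cosets of \<open>H\<close>, and then the elements inside each coset, identifies \<open>S\<close> with the
  vertices of the complete multipartite graph in such a way that the parts are the cosets.\<close>

lemma ex_coset_coordinates:
  fixes S H :: "'a::ab_group_add set"
  assumes S: "add_subgroup S" and H: "add_subgroup H" "H \<subseteq> S"
    and fin: "finite S" and card: "card S = m * n" "card H = n"
  shows "\<exists>f. bij_betw f S ({..<m} \<times> {..<n}) \<and>
             (\<forall>x\<in>S. \<forall>y\<in>S. fst (f x) = fst (f y) \<longleftrightarrow> x - y \<in> H)"
proof -
  define coset where "coset x = (+) x ` H" for x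
  define C where "C = coset ` S"
  have finH: "finite H" using fin H(2) finite_subset by blast
  have "0 < n" using card(2) finH H(1) add_subgroup_zero[of H] by (auto simp: card_gt_0_iff)
  have mem: "y \<in> coset x \<longleftrightarrow> y - x \<in> H" for x y
    unfolding coset_def by (metis add_diff_cancel_left' diff_add_cancel add.commute imageE imageI)
  have eq: "coset x = coset y \<longleftrightarrow> x - y \<in> H" for x y
  proof
    assume "coset x = coset y"
    then show "x - y \<in> H" using mem[of x y] mem[of x x] H(1) by (simp add: add_subgroup_zero)
  next
    assume *: "x - y \<in> H"
    have "z - x \<in> H \<longleftrightarrow> z - y \<in> H" for z
    proof
      assume "z - x \<in> H"
      from add_subgroup_add[OF H(1) this *] show "z - y \<in> H" by simp
    next
      assume "z - y \<in> H"
      from add_subgroup_diff[OF H(1) this *] show "z - x \<in> H" by simp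
    qed
    then show "coset x = coset y" using mem by auto
  qed
  have self: "x \<in> coset x" for x using mem[of x x] H(1) by (simp add: add_subgroup_zero)
  have sub: "coset x \<subseteq> S" if "x \<in> S" for x
    using that H(2) S by (auto simp: coset_def intro!: add_subgroup_add)
  have cardc: "card (coset x) = n" for x
    using card(2) unfolding coset_def by (simp add: card_image)
  have UC: "\<Union>C = S" using sub self by (auto simp: C_def)
  have finC: "finite C" using fin by (simp add: C_def)
  have "n * card C = card (\<Union>C)"
  proof (rule card_partition)
    show "finite C" "finite (\<Union>C)" using finC fin UC by auto
    show "card c = n" if "c \<in> C" for c using that cardc by (auto simp: C_def)
    show "c1 \<inter> c2 = {}" if "c1 \<in> C" "c2 \<in> C" "c1 \<noteq> c2" for c1 c2
    proof -
      obtain x y where c: "c1 = coset x" "c2 = coset y" using \<open>c1 \<in> C\<close> \<open>c2 \<in> C\<close> by (auto simp: C_def)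
      have False if "z \<in> c1" "z \<in> c2" for z
        using that c \<open>c1 \<noteq> c2\<close> mem eq by metis
      then show ?thesis by blast
    qed
  qed
  then have cardC: "card C = m" using UC card(1) \<open>0 < n\<close> by simp
  obtain k where k: "bij_betw k C {..<m}"
    using finC cardC ex_bij_betw_finite_nat[of C] by (auto simp: atLeast0LessThan)
  have "\<exists>i. bij_betw i (coset x) {..<n}" for x
    using ex_bij_betw_finite_nat[of "coset x"] cardc[of x] finH
    by (auto simp: atLeast0LessThan coset_def)
  then have "\<forall>c\<in>C. \<exists>i. bij_betw i c {..<n}" by (auto simp: C_def)
  then obtain i where i: "\<And>c. c \<in> C \<Longrightarrow> bij_betw (i c) c {..<n}" by metis
  define f where "f x = (k (coset x), i (coset x) x)" for x
  have fst_f: "fst (f x) = fst (f y) \<longleftrightarrow> x - y \<in> H" if "x \<in> S" "y \<in> S" for x y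
  proof -
    have "k (coset x) = k (coset y) \<longleftrightarrow> coset x = coset y"
      using that k by (intro inj_on_eq_iff[of k C]) (auto simp: C_def bij_betw_def)
    then show ?thesis by (simp add: f_def eq)
  qed
  have inj: "inj_on f S"
  proof (rule inj_onI)
    fix x y assume xy: "x \<in> S" "y \<in> S" "f x = f y"
    then have "coset x = coset y" using fst_f[of x y] eq by simp
    moreover have "i (coset x) x = i (coset y) y" using xy(3) by (simp add: f_def)
    ultimately show "x = y" using i[of "coset x"] self[of x] self[of y] xy(1)
      by (auto simp: C_def bij_betw_def inj_on_def)
  qed
  have "f ` S \<subseteq> {..<m} \<times> {..<n}"
  proof
    fix p assume "p \<in> f ` S"
    then obtain x where x: "x \<in> S" "p = f x" by auto
    then have "coset x \<in> C" by (simp add: C_def)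
    then show "p \<in> {..<m} \<times> {..<n}"
      using x k i[of "coset x"] self[of x] unfolding f_def bij_betw_def by blast
  qed
  moreover have "card (f ` S) = card ({..<m} \<times> {..<n})"
    using inj card(1) by (simp add: card_image)
  ultimately have "f ` S = {..<m} \<times> {..<n}" by (intro card_subset_eq) auto
  then show ?thesis using inj fst_f unfolding bij_betw_def by blast
qed

text \<open>A one-factor is the same thing as a fixed-point-free involution that sends each vertex to its
  partner. So a one-factorization of the graph on \<open>S\<close> whose edges join elements of different cosets
  of \<open>H\<close> is a set of involutions exactly one of which sends a given \<open>x\<close> to a given \<open>y\<close> outside its
  coset. When this set is closed under conjugation by translations, the translations of \<open>S\<close>
  form the required abelian, sharply transitive group.\<close>

lemma abelian_one_factorization_from_involutions:
  fixes S H :: "'a::ab_group_add set" and \<Sigma> :: "('a \<Rightarrow> 'a) set"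
  assumes S: "add_subgroup S" and H: "add_subgroup H" "H \<subseteq> S"
    and fin: "finite S" and card: "card S = m * n" "card H = n"
    and closed: "\<And>\<sigma> x. \<sigma> \<in> \<Sigma> \<Longrightarrow> x \<in> S \<Longrightarrow> \<sigma> x \<in> S"
    and invol: "\<And>\<sigma> x. \<sigma> \<in> \<Sigma> \<Longrightarrow> x \<in> S \<Longrightarrow> \<sigma> (\<sigma> x) = x"
    and diff: "\<And>\<sigma> x. \<sigma> \<in> \<Sigma> \<Longrightarrow> x \<in> S \<Longrightarrow> \<sigma> x - x \<notin> H"
    and translate: "\<And>\<sigma> g. \<sigma> \<in> \<Sigma> \<Longrightarrow> g \<in> S \<Longrightarrow> \<exists>\<tau>\<in>\<Sigma>. \<forall>x\<in>S. \<tau> (x + g) = \<sigma> x + g"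
    and unique: "\<And>\<sigma> \<tau> x y. \<sigma> \<in> \<Sigma> \<Longrightarrow> \<tau> \<in> \<Sigma> \<Longrightarrow> x \<in> S \<Longrightarrow> y \<in> S \<Longrightarrow> \<sigma> x = \<tau> x \<Longrightarrow> \<sigma> y = \<tau> y"
    and covers: "\<And>x y. x \<in> S \<Longrightarrow> y \<in> S \<Longrightarrow> y - x \<notin> H \<Longrightarrow> \<exists>\<sigma>\<in>\<Sigma>. \<sigma> x = y"
  shows "\<exists>\<F>. abelian_one_factorization (complete_multipartite m n) \<F>"
proof -
  obtain f where f: "bij_betw f S ({..<m} \<times> {..<n})"
    and fst_f: "\<And>x y. x \<in> S \<Longrightarrow> y \<in> S \<Longrightarrow> fst (f x) = fst (f y) \<longleftrightarrow> x - y \<in> H"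
    using ex_coset_coordinates[OF S H fin card] by blast
  define V where "V = {..<m} \<times> {..<n}"
  define \<Gamma> where "\<Gamma> = complete_multipartite m n"
  have vert: "fst \<Gamma> = V" and edges: "snd \<Gamma> = {{x, y} | x y. x \<in> V \<and> y \<in> V \<and> fst x \<noteq> fst y}"
    by (auto simp: \<Gamma>_def complete_multipartite_def V_def Let_def)
  define h where "h = inv_into S f"
  have fV: "f x \<in> V" and hf: "h (f x) = x" if "x \<in> S" for x
    using f that by (auto simp: bij_betw_def V_def h_def)
  have hS: "h v \<in> S" and fh: "f (h v) = v" if "v \<in> V" for v
    using f that by (auto simp: bij_betw_def V_def h_def inv_into_into f_inv_into_f)
  have f_eq: "f x = f y \<longleftrightarrow> x = y" if "x \<in> S" "y \<in> S" for x y
    using hf that by metis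
  define E where "E \<sigma> = (\<lambda>x. {f x, f (\<sigma> x)}) ` S" for \<sigma>
  define \<F> where "\<F> = E ` \<Sigma>"
  have nonadj: "fst (f x) \<noteq> fst (f (\<sigma> x))" if "\<sigma> \<in> \<Sigma>" "x \<in> S" for \<sigma> x
    using fst_f[of "\<sigma> x" x] closed diff that by metis
  have at: "e = {f x, f (\<sigma> x)}" if "\<sigma> \<in> \<Sigma>" "x \<in> S" "e \<in> E \<sigma>" "f x \<in> e" for \<sigma> x e
  proof -
    obtain y where y: "y \<in> S" "e = {f y, f (\<sigma> y)}" using \<open>e \<in> E \<sigma>\<close> by (auto simp: E_def)
    then have "x = y \<or> x = \<sigma> y" using that f_eq closed by auto
    then show ?thesis using y invol[OF that(1) y(1)] by (auto simp: insert_commute)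
  qed
  have factor: "one_factor \<Gamma> (E \<sigma>)" if \<sigma>: "\<sigma> \<in> \<Sigma>" for \<sigma>
    unfolding one_factor_def vert
  proof (intro conjI ballI)
    show "E \<sigma> \<subseteq> snd \<Gamma>"
    proof
      fix e assume "e \<in> E \<sigma>"
      then obtain x where "x \<in> S" "e = {f x, f (\<sigma> x)}" by (auto simp: E_def)
      then show "e \<in> snd \<Gamma>" using nonadj[OF \<sigma>] closed[OF \<sigma>] fV unfolding edges by blast
    qed
    fix v assume v: "v \<in> V"
    define x where "x = h v"
    have x: "x \<in> S" "f x = v" using v hS fh by (auto simp: x_def)
    have "{e \<in> E \<sigma>. v \<in> e} = {{f x, f (\<sigma> x)}}"
      using at[OF \<sigma> x(1)] x by (auto simp: E_def)
    then show "degree (E \<sigma>) v = 1" by (simp add: degree_def)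
  qed
  have disj: "pairwise disjnt \<F>"
  proof (rule pairwiseI)
    fix F F' assume F: "F \<in> \<F>" "F' \<in> \<F>" "F \<noteq> F'"
    then obtain \<sigma> \<tau> where st: "\<sigma> \<in> \<Sigma>" "F = E \<sigma>" "\<tau> \<in> \<Sigma>" "F' = E \<tau>" by (auto simp: \<F>_def)
    have False if "e \<in> F" "e \<in> F'" for e
    proof -
      obtain x where x: "x \<in> S" "e = {f x, f (\<sigma> x)}"
        using \<open>e \<in> F\<close> st by (auto simp: E_def)
      then have "{f x, f (\<sigma> x)} = {f x, f (\<tau> x)}"
        using at[OF st(3) x(1), of e] that st by auto
      then have "\<sigma> x = \<tau> x" using f_eq closed st x by (metis doubleton_eq_iff)
      then have "\<sigma> y = \<tau> y" if "y \<in> S" for y using unique st x that by blast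
      then have "E \<sigma> = E \<tau>" by (auto simp: E_def)
      then show False using F st by simp
    qed
    then show "disjnt F F'" by (auto simp: disjnt_def)
  qed
  have cover: "\<Union>\<F> = snd \<Gamma>"
  proof
    show "\<Union>\<F> \<subseteq> snd \<Gamma>" using factor by (auto simp: \<F>_def one_factor_def)
    show "snd \<Gamma> \<subseteq> \<Union>\<F>"
    proof
      fix e assume "e \<in> snd \<Gamma>"
      then obtain u v where uv: "e = {u, v}" "u \<in> V" "v \<in> V" "fst u \<noteq> fst v" by (auto simp: edges)
      then have "h v - h u \<notin> H" using fst_f[of "h v" "h u"] hS fh by auto
      then obtain \<sigma> where "\<sigma> \<in> \<Sigma>" "\<sigma> (h u) = h v" using covers hS uv by meson
      moreover have "h u \<in> S" "f (h u) = u" "f (h v) = v" using uv hS fh by blast+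
      ultimately have "e \<in> E \<sigma>"
        unfolding E_def using uv(1) by (intro image_eqI[of _ _ "h u"]) simp_all
      then show "e \<in> \<Union>\<F>" using \<open>\<sigma> \<in> \<Sigma>\<close> by (auto simp: \<F>_def)
    qed
  qed
  define tr where "tr a = (\<lambda>v\<in>V. f (h v + a))" for a
  define G where "G = tr ` S"
  have trV: "tr a v \<in> V" if "a \<in> S" "v \<in> V" for a v
    using that hS fV S by (simp add: tr_def add_subgroup_add)
  have tr_tr: "tr a (tr b v) = tr (a + b) v" if "a \<in> S" "b \<in> S" "v \<in> V" for a b v
    using that hS fV hf S by (simp add: tr_def add_subgroup_add ac_simps)
  have tr_0: "tr 0 = (\<lambda>v\<in>V. v)" using fh by (auto simp: tr_def)
  have tr_Bij: "tr a \<in> Bij V" if a: "a \<in> S" for a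
  proof -
    have "bij_betw (tr a) V V"
    proof (rule bij_betw_byWitness[where f' = "tr (- a)"])
      show "\<forall>v\<in>V. tr (- a) (tr a v) = v" "\<forall>v\<in>V. tr a (tr (- a) v) = v"
        using a S by (auto simp: tr_tr add_subgroup_uminus tr_0)
    qed (use trV a S add_subgroup_uminus in blast)+
    then show ?thesis by (simp add: Bij_def tr_def)
  qed
  have tr_comp: "compose V (tr a) (tr b) = tr (a + b)" if "a \<in> S" "b \<in> S" for a b
  proof
    fix v
    show "compose V (tr a) (tr b) v = tr (a + b) v"
    proof (cases "v \<in> V")
      case True
      then show ?thesis using that tr_tr by (simp add: compose_def)
    next
      case False
      then show ?thesis by (simp add: compose_def tr_def)
    qed
  qed
  interpret B: group "BijGroup V" by (rule group_BijGroup)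
  have mult: "tr a \<otimes>\<^bsub>BijGroup V\<^esub> tr b = tr (a + b)" if "a \<in> S" "b \<in> S" for a b
    using that tr_Bij tr_comp by (simp add: BijGroup_def)
  have one: "\<one>\<^bsub>BijGroup V\<^esub> = tr 0" by (simp add: BijGroup_def tr_0)
  have sub: "subgroup G (BijGroup V)"
  proof (rule B.subgroupI)
    show "G \<subseteq> carrier (BijGroup V)" using tr_Bij by (auto simp: G_def BijGroup_def)
    show "G \<noteq> {}" using S by (auto simp: G_def add_subgroup_def)
  next
    fix g assume "g \<in> G"
    then obtain a where a: "a \<in> S" "g = tr a" by (auto simp: G_def)
    have "tr (- a) \<otimes>\<^bsub>BijGroup V\<^esub> tr a = \<one>\<^bsub>BijGroup V\<^esub>"
      using a S by (simp add: mult add_subgroup_uminus one)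
    then have "inv\<^bsub>BijGroup V\<^esub> g = tr (- a)"
      using a S tr_Bij by (intro B.inv_equality) (auto simp: BijGroup_def add_subgroup_uminus)
    then show "inv\<^bsub>BijGroup V\<^esub> g \<in> G" using a S by (simp add: G_def add_subgroup_uminus)
  next
    fix g g' assume "g \<in> G" "g' \<in> G"
    then show "g \<otimes>\<^bsub>BijGroup V\<^esub> g' \<in> G" using S mult by (auto simp: G_def add_subgroup_add)
  qed
  have comm: "comm_group ((BijGroup V)\<lparr>carrier := G\<rparr>)"
  proof (rule group.group_comm_groupI)
    show "Group.group ((BijGroup V)\<lparr>carrier := G\<rparr>)"
      by (rule B.subgroup_imp_group[OF sub])
    fix x y assume "x \<in> carrier ((BijGroup V)\<lparr>carrier := G\<rparr>)" "y \<in> carrier ((BijGroup V)\<lparr>carrier := G\<rparr>)"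
    then show "x \<otimes>\<^bsub>(BijGroup V)\<lparr>carrier := G\<rparr>\<^esub> y = y \<otimes>\<^bsub>(BijGroup V)\<lparr>carrier := G\<rparr>\<^esub> x"
      using mult by (auto simp: G_def ac_simps)
  qed
  have auto: "(\<lambda>e. g ` e) ` F \<in> \<F>" if "g \<in> G" "F \<in> \<F>" for g F
  proof -
    obtain a where a: "a \<in> S" "g = tr a" using \<open>g \<in> G\<close> by (auto simp: G_def)
    obtain \<sigma> where \<sigma>: "\<sigma> \<in> \<Sigma>" "F = E \<sigma>" using \<open>F \<in> \<F>\<close> by (auto simp: \<F>_def)
    obtain \<tau> where \<tau>: "\<tau> \<in> \<Sigma>" "\<And>x. x \<in> S \<Longrightarrow> \<tau> (x + a) = \<sigma> x + a"
      using translate[OF \<sigma>(1) a(1)] by blast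
    have img: "g ` {f x, f (\<sigma> x)} = {f (x + a), f (\<tau> (x + a))}" if "x \<in> S" for x
      using that a \<sigma> \<tau> fV hf closed by (simp add: tr_def)
    have "(\<lambda>e. g ` e) ` F = (\<lambda>x. {f (x + a), f (\<tau> (x + a))}) ` S"
      unfolding \<sigma> E_def image_image using img by (intro image_cong) auto
    also have "\<dots> = (\<lambda>x. {f x, f (\<tau> x)}) ` (\<lambda>x. x + a) ` S" by (simp add: image_image)
    also have "(\<lambda>x. x + a) ` S = S"
    proof
      show "(\<lambda>x. x + a) ` S \<subseteq> S" using a S by (auto intro: add_subgroup_add)
      show "S \<subseteq> (\<lambda>x. x + a) ` S"
        using a S by (auto intro!: image_eqI[of _ _ "_ - a"] add_subgroup_diff)
    qed
    finally show ?thesis using \<tau>(1) by (simp add: \<F>_def E_def)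
  qed
  have sharp: "sharply_transitive_on V G"
    unfolding sharply_transitive_on_def
  proof (intro ballI)
    fix u v assume uv: "u \<in> V" "v \<in> V"
    show "\<exists>!g. g \<in> G \<and> g u = v"
    proof (rule ex1I[of _ "tr (h v - h u)"])
      show "tr (h v - h u) \<in> G \<and> tr (h v - h u) u = v"
        using uv hS fh S by (auto simp: G_def tr_def add_subgroup_diff)
      fix g assume "g \<in> G \<and> g u = v"
      then obtain a where a: "a \<in> S" "g = tr a" "f (h u + a) = v" using uv by (auto simp: G_def tr_def)
      then have "h v = h u + a" using hf[of "h u + a"] hS uv S add_subgroup_add by metis
      then show "g = tr (h v - h u)" using a by simp
    qed
  qed
  have "abelian_one_factorization \<Gamma> \<F>"
    unfolding abelian_one_factorization_def one_factorization_def automorphism_group_of_def vert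
    using factor disj cover sub comm auto sharp by (auto simp: \<F>_def)
  then show ?thesis by (auto simp: \<Gamma>_def)
qed

text \<open>It suffices to give one representative \<open>\<sigma>\<close> for each orbit of factors under translations.
  The differences \<open>\<sigma> u - u\<close> are invariant under translation. Hence the translates of the family \<open>\<B>\<close>
  are edge-disjoint as soon as an equality of two such differences forces the corresponding
  translates to coincide; this is the hypothesis on orbits.

  A difference \<open>d\<close> that does not arise from \<open>\<B>\<close> can be handled on its own if it lies outside some
  subgroup of index two, the kernel of \<open>\<chi> d\<close>: the graph joining \<open>x\<close> to \<open>x \<plusminus> d\<close> is then
  the union of the factor joining every \<open>x\<close> in the kernel to \<open>x + d\<close> and of its translates, of
  which at most one is different. So \<open>\<B>\<close>
  really only has to deal with the differences in \<open>2 S\<close>, which lie in all subgroups of index two.\<close>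

lemma abelian_one_factorization_from_starters:
  fixes S H :: "'a::ab_group_add set" and \<B> :: "('a \<Rightarrow> 'a) set" and \<chi> :: "'a \<Rightarrow> 'a \<Rightarrow> bool"
  assumes S: "add_subgroup S" and H: "add_subgroup H" "H \<subseteq> S"
    and fin: "finite S" and card: "card S = m * n" "card H = n"
    and closed: "\<And>\<sigma> x. \<sigma> \<in> \<B> \<Longrightarrow> x \<in> S \<Longrightarrow> \<sigma> x \<in> S"
    and invol: "\<And>\<sigma> x. \<sigma> \<in> \<B> \<Longrightarrow> x \<in> S \<Longrightarrow> \<sigma> (\<sigma> x) = x"
    and diff: "\<And>\<sigma> x. \<sigma> \<in> \<B> \<Longrightarrow> x \<in> S \<Longrightarrow> \<sigma> x - x \<notin> H"
    and orbit: "\<And>\<sigma> \<tau> u v x. \<sigma> \<in> \<B> \<Longrightarrow> \<tau> \<in> \<B> \<Longrightarrow> u \<in> S \<Longrightarrow> v \<in> S \<Longrightarrow> x \<in> S \<Longrightarrow>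
            \<sigma> u - u = \<tau> v - v \<Longrightarrow> \<tau> (x + (v - u)) = \<sigma> x + (v - u)"
    and char: "\<And>d. d \<in> S \<Longrightarrow> d \<notin> H \<Longrightarrow> (\<forall>\<sigma>\<in>\<B>. \<forall>x\<in>S. \<sigma> x - x \<noteq> d) \<Longrightarrow>
            \<chi> d d \<and> (\<forall>x\<in>S. \<forall>y\<in>S. \<chi> d (x + y) \<longleftrightarrow> \<chi> d x \<noteq> \<chi> d y) \<and> (\<forall>x\<in>S. \<chi> (- d) x = \<chi> d x)"
  shows "\<exists>\<F>. abelian_one_factorization (complete_multipartite m n) \<F>"
proof -
  define R where "R = {d \<in> S - H. \<forall>\<sigma>\<in>\<B>. \<forall>x\<in>S. \<sigma> x - x \<noteq> d}"
  \<comment> \<open>The two differences \<open>d\<close> and \<open>- d\<close> give the same pair of factors, because \<open>\<chi> (- d)\<close> and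
    \<open>\<chi> d\<close> agree; this is why no choice between them is made.\<close>
  define pure where "pure d = (\<lambda>x. if \<chi> d x then x - d else x + d)" for d
  have R_uminus: "- d \<in> R" if "d \<in> R" for d
    using that S H(1) unfolding R_def mem_Collect_eq
  proof (intro conjI ballI)
    show "- d \<in> S - H" using that S H(1) add_subgroup_uminus[of H "- d"]
      by (auto simp: R_def add_subgroup_uminus)
    fix \<sigma> x assume "\<sigma> \<in> \<B>" "x \<in> S"
    then have "\<sigma> (\<sigma> x) - \<sigma> x \<noteq> d" using that closed by (auto simp: R_def)
    then show "\<sigma> x - x \<noteq> - d" using invol \<open>\<sigma> \<in> \<B>\<close> \<open>x \<in> S\<close> by (metis minus_diff_eq minus_minus)
  qed
  have chi: "\<chi> d d" "\<And>x y. x \<in> S \<Longrightarrow> y \<in> S \<Longrightarrow> \<chi> d (x + y) \<longleftrightarrow> \<chi> d x \<noteq> \<chi> d y"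
    "\<And>x. x \<in> S \<Longrightarrow> \<chi> (- d) x = \<chi> d x" "d \<in> S" "d \<notin> H" if "d \<in> R" for d
    using char[of d] that by (auto simp: R_def)
  have chi_diff: "\<chi> d (x - y) \<longleftrightarrow> \<chi> d x \<noteq> \<chi> d y" if "d \<in> R" "x \<in> S" "y \<in> S" for d x y
    using chi(2)[OF that(1), of "x - y" y] that S by (auto simp: add_subgroup_diff)
  define \<B>' where "\<B>' = \<B> \<union> pure ` R"
  have pure_diff: "pure d x - x = (if \<chi> d x then - d else d)" for d x
    by (simp add: pure_def)
  have closed': "\<sigma> x \<in> S" if "\<sigma> \<in> \<B>'" "x \<in> S" for \<sigma> x
    using that closed chi(4) S by (auto simp: \<B>'_def pure_def add_subgroup_add add_subgroup_diff)
  have invol': "\<sigma> (\<sigma> x) = x" if "\<sigma> \<in> \<B>'" "x \<in> S" for \<sigma> x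
    using that invol chi(1,2,4) chi_diff by (auto simp: \<B>'_def pure_def)
  have diff': "\<sigma> x - x \<notin> H" if "\<sigma> \<in> \<B>'" "x \<in> S" for \<sigma> x
    using that diff chi(5) chi(5)[OF R_uminus] by (auto simp: \<B>'_def pure_diff split: if_splits)
  have pure_orbit: "pure d' (x + (v - u)) = pure d x + (v - u)"
    if d: "d \<in> R" "d' \<in> R" and uvx: "u \<in> S" "v \<in> S" "x \<in> S"
      and eq: "pure d u - u = pure d' v - v" for d d' u v x
  proof -
    have vu: "v - u \<in> S" using uvx S by (simp add: add_subgroup_diff)
    consider "d' = d" "\<chi> d u = \<chi> d v" | "d' = - d" "\<chi> d u \<noteq> \<chi> d v"
    proof (cases "\<chi> d u = \<chi> d' v")
      case True
      then have "d' = d" using eq by (simp add: pure_diff split: if_splits)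
      then show ?thesis using that True by simp
    next
      case False
      then have "d' = - d" using eq by (auto simp: pure_diff split: if_splits)
      then show ?thesis using that False chi(3)[OF d(1) uvx(2)] by simp
    qed
    then show ?thesis
    proof cases
      case 1
      then have "\<chi> d (x + (v - u)) = \<chi> d x"
        using chi(2)[OF d(1) uvx(3) vu] chi_diff[OF d(1) uvx(2,1)] by simp
      then show ?thesis using 1 by (simp add: pure_def)
    next
      case 2
      then have "\<chi> d' (x + (v - u)) \<noteq> \<chi> d x"
        using chi(2)[OF d(1) uvx(3) vu] chi_diff[OF d(1) uvx(2,1)]
          chi(3)[OF d(1), of "x + (v - u)"] uvx vu S by (simp add: add_subgroup_add)
      then show ?thesis using 2 by (simp add: pure_def)
    qed
  qed
  have not_R: "\<sigma> x - x \<noteq> pure d y - y" if "\<sigma> \<in> \<B>" "x \<in> S" "d \<in> R" for \<sigma> x d y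
  proof -
    have "\<sigma> x - x \<noteq> d" "\<sigma> x - x \<noteq> - d"
      using that R_uminus[OF that(3)] unfolding R_def by blast+
    then show ?thesis by (simp add: pure_diff)
  qed
  have orbit': "\<tau> (x + (v - u)) = \<sigma> x + (v - u)"
    if "\<sigma> \<in> \<B>'" "\<tau> \<in> \<B>'" "u \<in> S" "v \<in> S" "x \<in> S" "\<sigma> u - u = \<tau> v - v" for \<sigma> \<tau> u v x
  proof -
    have st: "\<sigma> \<in> \<B>'" "\<tau> \<in> \<B>'" using that by auto
    consider "\<sigma> \<in> \<B>" "\<tau> \<in> \<B>" | d where "\<sigma> \<in> \<B>" "d \<in> R" "\<tau> = pure d"
      | d where "\<tau> \<in> \<B>" "d \<in> R" "\<sigma> = pure d"
      | d d' where "d \<in> R" "d' \<in> R" "\<sigma> = pure d" "\<tau> = pure d'"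
      using st unfolding \<B>'_def by blast
    then show ?thesis
    proof cases
      case 1
      then show ?thesis using orbit that(3-6) by blast
    next
      case 2
      then show ?thesis using not_R[of \<sigma> u d v] that(3,6) by simp
    next
      case 3
      then show ?thesis using not_R[of \<tau> v d u] that(4,6) by simp
    next
      case 4
      then show ?thesis using pure_orbit[OF 4(1,2) that(3-5)] that(6) by simp
    qed
  qed
  have covers': "\<exists>\<sigma>\<in>\<B>'. \<exists>u\<in>S. \<sigma> u - u = d" if "d \<in> S" "d \<notin> H" for d
  proof (cases "d \<in> R")
    case True
    then have "pure d 0 - 0 = d" using chi(2)[OF True, of 0 0] S by (auto simp: pure_def add_subgroup_zero)
    moreover have "pure d \<in> \<B>'" "0 \<in> S" using True S by (auto simp: \<B>'_def add_subgroup_zero)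
    ultimately show ?thesis by blast
  next
    case False
    then show ?thesis using that by (auto simp: R_def \<B>'_def)
  qed
  define \<Sigma> where "\<Sigma> = {\<lambda>x. \<sigma> (x - g) + g | \<sigma> g. \<sigma> \<in> \<B>' \<and> g \<in> S}"
  show ?thesis
  proof (rule abelian_one_factorization_from_involutions[OF S H fin card, of \<Sigma>])
    fix \<sigma> x assume "\<sigma> \<in> \<Sigma>" and x: "x \<in> S"
    then obtain \<beta> g where \<beta>: "\<beta> \<in> \<B>'" "g \<in> S" "\<sigma> = (\<lambda>x. \<beta> (x - g) + g)" by (auto simp: \<Sigma>_def)
    have xg: "x - g \<in> S" using x \<beta> S by (simp add: add_subgroup_diff)
    show "\<sigma> x \<in> S" "\<sigma> (\<sigma> x) = x" "\<sigma> x - x \<notin> H"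
      using closed'[OF \<beta>(1) xg] invol'[OF \<beta>(1) xg] diff'[OF \<beta>(1) xg] \<beta> S
      by (auto simp: add_subgroup_add algebra_simps)
  next
    fix \<sigma> g assume "\<sigma> \<in> \<Sigma>" and g: "g \<in> S"
    then obtain \<beta> k where \<beta>: "\<beta> \<in> \<B>'" "k \<in> S" "\<sigma> = (\<lambda>x. \<beta> (x - k) + k)" by (auto simp: \<Sigma>_def)
    have "k + g \<in> S" using \<beta> g S by (simp add: add_subgroup_add)
    then have "(\<lambda>x. \<beta> (x - (k + g)) + (k + g)) \<in> \<Sigma>" using \<beta>(1) unfolding \<Sigma>_def by blast
    then show "\<exists>\<tau>\<in>\<Sigma>. \<forall>x\<in>S. \<tau> (x + g) = \<sigma> x + g"
      by (rule bexI[rotated]) (auto simp: \<beta> algebra_simps)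
  next
    fix \<sigma> \<tau> x y assume st: "\<sigma> \<in> \<Sigma>" "\<tau> \<in> \<Sigma>" and x: "x \<in> S" "y \<in> S" "\<sigma> x = \<tau> x"
    obtain \<beta> g where \<beta>: "\<beta> \<in> \<B>'" "g \<in> S" "\<sigma> = (\<lambda>x. \<beta> (x - g) + g)" using st by (auto simp: \<Sigma>_def)
    obtain \<gamma> k where \<gamma>: "\<gamma> \<in> \<B>'" "k \<in> S" "\<tau> = (\<lambda>x. \<gamma> (x - k) + k)" using st by (auto simp: \<Sigma>_def)
    have "\<beta> (x - g) - (x - g) = \<gamma> (x - k) - (x - k)"
      using x \<beta> \<gamma> by (simp add: algebra_simps)
    from orbit'[OF \<beta>(1) \<gamma>(1) _ _ _ this, of "y - g"]
    have "\<gamma> (y - g + (x - k - (x - g))) = \<beta> (y - g) + (x - k - (x - g))"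
      using x \<beta> \<gamma> S by (simp add: add_subgroup_diff)
    then show "\<sigma> y = \<tau> y" using \<beta>(3) \<gamma>(3) by (simp add: algebra_simps)
  next
    fix x y assume xy: "x \<in> S" "y \<in> S" "y - x \<notin> H"
    then obtain \<beta> u where u: "\<beta> \<in> \<B>'" "u \<in> S" "\<beta> u - u = y - x"
      using covers'[of "y - x"] S by (auto simp: add_subgroup_diff)
    have "x - u \<in> S" using u xy S by (simp add: add_subgroup_diff)
    then have "(\<lambda>z. \<beta> (z - (x - u)) + (x - u)) \<in> \<Sigma>" using u(1) unfolding \<Sigma>_def by blast
    then show "\<exists>\<sigma>\<in>\<Sigma>. \<sigma> x = y"
      by (rule bexI[rotated]) (use u in \<open>simp add: algebra_simps\<close>)
  qed
qed

section \<open>Subgroups of odd order\<close>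

definition odd_subgroup :: "'a::ab_group_add set \<Rightarrow> bool" where
  "odd_subgroup P \<longleftrightarrow> add_subgroup P \<and> finite P \<and> (\<forall>x\<in>P. x + x = 0 \<longrightarrow> x = 0)"

lemma odd_subgroup_double_cancel:
  assumes "odd_subgroup P" "x \<in> P" "y \<in> P" "x + x = y + y"
  shows "x = y"
proof -
  have "(x - y) + (x - y) = 0" using assms(4) by (simp add: algebra_simps)
  then have "x - y = 0" using assms by (auto simp: odd_subgroup_def add_subgroup_diff)
  then show ?thesis by simp
qed

lemma odd_subgroup_half:
  assumes "odd_subgroup P" "y \<in> P"
  obtains x where "x \<in> P" "y = x + x"
proof -
  have "inj_on (\<lambda>x. x + x) P" using odd_subgroup_double_cancel[OF assms(1)] by (auto simp: inj_on_def)
  moreover have "(\<lambda>x. x + x) ` P \<subseteq> P" using assms(1) by (auto simp: odd_subgroup_def add_subgroup_add)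
  ultimately have "(\<lambda>x. x + x) ` P = P" using assms(1) by (intro endo_inj_surj) (auto simp: odd_subgroup_def)
  then show thesis using assms(2) that by blast
qed

lemma bit_add_self [simp]: "x + x = (0::bit)"
  by (cases x) simp_all

section \<open>Products of an elementary abelian 2-group and a group of odd order\<close>

text \<open>The elementary abelian 2-group of order \<open>2 ^ r\<close>; its subgroups of index two that are needed
  are the kernels of the coordinate functions.\<close>

definition bit_vectors :: "nat \<Rightarrow> (nat \<Rightarrow> bit) set" where
  "bit_vectors r = {t. \<forall>k\<ge>r. t k = 0}"

lemma bit_vectors_add_subgroup: "add_subgroup (bit_vectors r)"
  by (auto simp: add_subgroup_def bit_vectors_def)

lemma card_bit_vectors: "card (bit_vectors r) = 2 ^ r"
proof -
  have "bij_betw (\<lambda>t. {k. t k = 1}) (bit_vectors r) (Pow {..<r})"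
  proof (rule bij_betw_byWitness[where f' = "\<lambda>K k. if k \<in> K then 1 else 0"])
    show "(\<lambda>t. {k. t k = 1}) ` bit_vectors r \<subseteq> Pow {..<r}"
      by (auto simp: bit_vectors_def) (metis not_le_imp_less zero_neq_one)
  qed (auto simp: bit_vectors_def fun_eq_iff)
  then show ?thesis by (simp add: bij_betw_same_card card_Pow)
qed

lemma finite_bit_vectors: "finite (bit_vectors r)"
  using card_bit_vectors[of r] by (metis card.infinite power_not_zero zero_neq_numeral)

text \<open>The elements of \<open>S = T \<times> P\<close> that lie in all subgroups of index two are those of \<open>0 \<times> P\<close>, so one
  factor has to realize all differences in \<open>P - Q\<close>. The pairs \<open>{x, - x}\<close> have the differences
  \<open>\<plusminus> 2 x\<close>, and these run through each element of \<open>P - {0}\<close> once since doubling permutes \<open>P\<close>. The pairs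
  with \<open>x \<in> Q\<close> (including \<open>x = 0\<close>) must be avoided: they are moved out of the subgroup \<open>H\<close> by the
  second unit vector of \<open>T\<close>, while the first one belongs to \<open>H\<close>. The factor is invariant
  under \<open>T\<close>, and no translation by another element of \<open>S\<close> preserves it.\<close>

lemma abelian_one_factorization_elementary_times_odd:
  fixes P Q :: "'a::ab_group_add set"
  assumes P: "odd_subgroup P" and Q: "add_subgroup Q" "Q \<subseteq> P"
    and card: "card P = c * b" "card Q = b" and v: "v \<ge> 1"
  shows "\<exists>\<F>. abelian_one_factorization (complete_multipartite (2 ^ v * c) (2 * b)) \<F>"
proof -
  define unit :: "nat \<Rightarrow> nat \<Rightarrow> bit" where "unit i = (\<lambda>k. if k = i then 1 else 0)" for i
  define T where "T = bit_vectors (Suc v)"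
  define S where "S = T \<times> P"
  define H where "H = {0, unit 0} \<times> Q"
  define \<sigma> :: "(nat \<Rightarrow> bit) \<times> 'a \<Rightarrow> _" where
    "\<sigma> u = (if snd u \<in> Q then fst u + unit 1 else fst u, - snd u)" for u
  define \<chi> :: "(nat \<Rightarrow> bit) \<times> 'a \<Rightarrow> (nat \<Rightarrow> bit) \<times> 'a \<Rightarrow> bool" where
    "\<chi> d u = (fst u (LEAST k. fst d k = 1) = 1)" for d u
  have T: "add_subgroup T" by (simp add: T_def bit_vectors_add_subgroup)
  have P': "add_subgroup P" "finite P" using P by (auto simp: odd_subgroup_def)
  have unit: "unit 0 \<in> T" "unit 1 \<in> T" "unit 1 \<noteq> unit 0" "unit 1 \<noteq> 0" "unit 0 \<noteq> 0" "\<And>i. unit i + unit i = 0" "\<And>i. - unit i = unit i"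
    using v by (auto simp: unit_def T_def bit_vectors_def fun_eq_iff)
  have S: "add_subgroup S" using T P' by (auto simp: add_subgroup_def S_def zero_prod_def)
  have H: "add_subgroup H"
    using Q(1) unit by (auto simp: add_subgroup_def H_def zero_prod_def)
  have HS: "H \<subseteq> S" using Q unit T by (auto simp: H_def S_def add_subgroup_zero)
  have Q_uminus: "- x \<in> Q \<longleftrightarrow> x \<in> Q" for x
    using add_subgroup_uminus[OF Q(1), of x] add_subgroup_uminus[OF Q(1), of "- x"] by auto
  have Q_double: "x \<in> Q" if "x \<in> P" "x + x \<in> Q" for x
  proof -
    have "odd_subgroup Q" using P Q finite_subset by (auto simp: odd_subgroup_def)
    from odd_subgroup_half[OF this that(2)] obtain y where "y \<in> Q" "x + x = y + y" .
    then show ?thesis using odd_subgroup_double_cancel[OF P that(1), of y] Q by auto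
  qed
  show ?thesis
  proof (rule abelian_one_factorization_from_starters[OF S H HS, of _ _ "{\<sigma>}" \<chi>])
    show "finite S" using P' by (simp add: S_def T_def finite_bit_vectors)
    show "card S = 2 ^ v * c * (2 * b)"
      using card by (simp add: S_def T_def card_cartesian_product card_bit_vectors)
    show "card H = 2 * b" using card unit by (simp add: H_def card_cartesian_product)
  next
    fix \<sigma>' u assume u: "\<sigma>' \<in> {\<sigma>}" "u \<in> S"
    show "\<sigma>' u \<in> S" using u T P' unit
      by (auto simp: S_def \<sigma>_def add_subgroup_add add_subgroup_uminus)
    show "\<sigma>' (\<sigma>' u) = u" using u Q_uminus unit(6)[of 1] by (auto simp: \<sigma>_def add.assoc)
    show "\<sigma>' u - u \<notin> H"
    proof
      assume "\<sigma>' u - u \<in> H"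
      then have "fst (\<sigma> u - u) \<in> {0, unit 0}" "snd (\<sigma> u - u) \<in> Q"
        using u unfolding H_def by (simp_all add: mem_Times_iff)
      moreover have "snd (\<sigma> u - u) = - (snd u + snd u)" by (simp add: \<sigma>_def)
      ultimately have *: "fst (\<sigma> u - u) \<in> {0, unit 0}" "- (snd u + snd u) \<in> Q" by simp_all
      then have "snd u + snd u \<in> Q" using Q_uminus[of "snd u + snd u"] by blast
      moreover have "snd u \<in> P" using u by (auto simp: S_def)
      ultimately have "snd u \<in> Q" by (rule Q_double[rotated])
      then have "fst (\<sigma> u - u) = unit 1" by (simp add: \<sigma>_def)
      then show False using * unit by auto
    qed
  next
    fix \<sigma>1 \<sigma>2 u w x
    assume s: "\<sigma>1 \<in> {\<sigma>}" "\<sigma>2 \<in> {\<sigma>}" and uwx: "u \<in> S" "w \<in> S" "x \<in> S" and "\<sigma>1 u - u = \<sigma>2 w - w"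
    then have "snd (\<sigma> u - u) = snd (\<sigma> w - w)" by simp
    then have "snd u + snd u = snd w + snd w" by (simp add: \<sigma>_def algebra_simps)
    then have "snd u = snd w" using odd_subgroup_double_cancel[OF P] uwx by (auto simp: S_def)
    then show "\<sigma>2 (x + (w - u)) = \<sigma>1 x + (w - u)"
      using s by (auto simp: \<sigma>_def prod_eq_iff algebra_simps)
  next
    fix d assume d: "d \<in> S" "d \<notin> H" "\<forall>\<sigma>'\<in>{\<sigma>}. \<forall>x\<in>S. \<sigma>' x - x \<noteq> d"
    have "fst d \<noteq> 0"
    proof
      assume 0: "fst d = 0"
      then have "snd d \<notin> Q" using d(2) by (cases d) (auto simp: H_def)
      have "snd d \<in> P" using d(1) by (auto simp: S_def)
      with odd_subgroup_half[OF P] obtain y where y: "y \<in> P" "snd d = y + y" by blast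
      then have "y \<notin> Q" using \<open>snd d \<notin> Q\<close> Q(1) add_subgroup_add by auto
      then have "\<sigma> (0, - y) - (0, - y) = d" using y 0 Q_uminus[of y] by (simp add: \<sigma>_def prod_eq_iff)
      moreover have "(0, - y) \<in> S" using y P' T by (simp add: S_def add_subgroup_uminus add_subgroup_zero)
      ultimately show False using d(3) by blast
    qed
    then have "\<exists>k. fst d k = 1" by (auto simp: fun_eq_iff)
    then have "fst d (LEAST k. fst d k = 1) = 1" by (rule LeastI_ex)
    moreover have "(a + b = 1) \<longleftrightarrow> ((a = 1) \<noteq> (b = 1))" for a b :: bit by (cases a; cases b) auto
    ultimately show "\<chi> d d \<and> (\<forall>x\<in>S. \<forall>y\<in>S. \<chi> d (x + y) \<longleftrightarrow> \<chi> d x \<noteq> \<chi> d y) \<and>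
        (\<forall>x\<in>S. \<chi> (- d) x = \<chi> d x)"
      by (simp add: \<chi>_def)
  qed
qed

section \<open>Products of the group of order two with two groups of odd order\<close>

text \<open>This describes the data on a group \<open>P\<close> of odd order from which factors of the group \<open>bit \<times> P \<times> W\<close>
  are built. The set \<open>P - {0}\<close> is divided into the two symmetric halves \<open>B - {0}\<close> and \<open>A - {0}\<close>,
  and \<open>\<tau>\<close> matches \<open>B\<close> with \<open>A\<close> in such a way that the differences \<open>\<tau> x - x\<close> are distinct; such
  symmetric halves can have equal size only if the order of \<open>P\<close> is 1 modulo 4. The element \<open>\<mu>\<close> is
  missed by these differences up to sign, \<open>\<nu>\<close> is any other nonzero element except \<open>- \<mu>\<close>, and \<open>N\<close> selects one element
  from each pair \<open>{x, - x}\<close>.\<close>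

locale split_odd_group =
  fixes P B A N :: "'a::ab_group_add set" and \<tau> :: "'a \<Rightarrow> 'a" and \<mu> \<nu> :: 'a
  assumes P: "odd_subgroup P"
    and BA: "B \<union> A = P" "B \<inter> A = {0}"
    and B_uminus: "x \<in> B \<Longrightarrow> - x \<in> B" and A_uminus: "x \<in> A \<Longrightarrow> - x \<in> A"
    and N: "x \<in> P \<Longrightarrow> x \<noteq> 0 \<Longrightarrow> - x \<in> N \<longleftrightarrow> x \<notin> N" 
    and \<tau>: "x \<in> B \<Longrightarrow> \<tau> x \<in> A" "x \<in> A \<Longrightarrow> \<tau> x \<in> B" "x \<in> P \<Longrightarrow> \<tau> (\<tau> x) = x"
    and \<tau>_inj: "x \<in> B \<Longrightarrow> y \<in> B \<Longrightarrow> \<tau> x - x = \<tau> y - y \<Longrightarrow> x = y"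
    and \<mu>: "\<mu> \<in> P" "\<mu> \<noteq> 0" "x \<in> B \<Longrightarrow> \<tau> x - x \<noteq> \<mu>" "x \<in> B \<Longrightarrow> \<tau> x - x \<noteq> - \<mu>"
    and \<nu>: "\<nu> \<in> P" "\<nu> \<noteq> 0" "\<nu> \<noteq> \<mu>" "\<nu> \<noteq> - \<mu>"
begin

lemma add_subgroup_P: "add_subgroup P" and finite_P: "finite P"
  using P by (auto simp: odd_subgroup_def)

lemmas closed = add_subgroup_closed[OF add_subgroup_P]

lemma zero_BA: "0 \<in> B" "0 \<in> A" using BA by auto

lemma uminus_mem: "- x \<in> B \<longleftrightarrow> x \<in> B" "- x \<in> A \<longleftrightarrow> x \<in> A" "- x \<in> P \<longleftrightarrow> x \<in> P"
  using B_uminus[of x] B_uminus[of "- x"] A_uminus[of x] A_uminus[of "- x"] closed by force+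

lemma not_self_neg: "x \<in> P \<Longrightarrow> x = - x \<Longrightarrow> x = 0"
  using P unfolding odd_subgroup_def by (metis add.left_inverse)

lemma double_cancel: "x \<in> P \<Longrightarrow> y \<in> P \<Longrightarrow> x + x = y + y \<Longrightarrow> x = y"
  using odd_subgroup_double_cancel[OF P] .

lemma double_cancel': "x \<in> P \<Longrightarrow> y \<in> P \<Longrightarrow> - x - x = - y - y \<Longrightarrow> x = y"
  using double_cancel[of x y] by (simp add: algebra_simps)

lemma double_0: "x \<in> P \<Longrightarrow> - x - x = 0 \<Longrightarrow> x = 0"
  using double_cancel'[of x 0] closed by simp

end

text \<open>In both levels of \<open>bit \<times> P\<close> only half of the pairs \<open>{x, - x}\<close> are used: those with \<open>x \<notin> B\<close> in level 0
  and those with \<open>x \<notin> A\<close> in level 1. Together they realize every difference in \<open>P - {0}\<close> once, up to translation in the third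
  coordinate. The
  vertices that are left over, \<open>B\<close> in level 0 and \<open>A\<close> in level 1, are matched by \<open>\<tau>\<close>, and the
  shift by \<open>c\<close> in the third coordinate keeps the resulting differences away from others.\<close>

definition split_pairing ::
    "'a::ab_group_add set \<Rightarrow> 'a set \<Rightarrow> ('a \<Rightarrow> 'a) \<Rightarrow> 'b::ab_group_add \<Rightarrow> bit \<times> 'a \<times> 'b \<Rightarrow> bit \<times> 'a \<times> 'b" where
  "split_pairing B A \<tau> c = (\<lambda>(e, x, b).
     if e = 0 then (if x \<in> B then (1, \<tau> x, b + c) else (0, - x, b))
     else (if x \<in> A then (0, \<tau> x, b - c) else (1, - x, b)))"

context split_odd_group
begin

lemma split_pairing_closed: "fst (snd u) \<in> P \<Longrightarrow> fst (snd (split_pairing B A \<tau> c u)) \<in> P"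
  using BA \<tau> by (auto simp: split_pairing_def uminus_mem split: prod.splits if_splits)

lemma split_pairing_invol: "fst (snd u) \<in> P \<Longrightarrow> split_pairing B A \<tau> c (split_pairing B A \<tau> c u) = u"
  using BA \<tau> by (auto simp: split_pairing_def uminus_mem split: prod.splits if_splits)

lemma split_pairing_translate:
  "split_pairing B A \<tau> c (u + (0, 0, b)) = split_pairing B A \<tau> c u + (0, 0, b)"
  by (auto simp: split_pairing_def algebra_simps split: prod.splits)

lemma split_pairing_diff:
  assumes u: "fst (snd u) \<in> P" and d: "split_pairing B A \<tau> c u - u = (e, z, w)"
  shows "(e = 0 \<and> z \<noteq> 0 \<and> w = 0) \<or> (e = 1 \<and> z \<noteq> \<mu> \<and> z \<noteq> - \<mu> \<and> (w = c \<or> w = - c))"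
proof -
  obtain f x b where u': "u = (f, x, b)" by (cases u) auto
  have x: "x \<in> P" using u u' by simp
  consider "f = 0" "x \<in> B" | "f = 0" "x \<notin> B" | "f = 1" "x \<in> A" | "f = 1" "x \<notin> A" by (cases f) auto
  then show ?thesis
  proof cases
    case 1
    then show ?thesis using d u' \<mu>(3,4)[of x] by (auto simp: split_pairing_def)
  next
    case 2
    then have "x \<noteq> 0" using zero_BA by auto
    then show ?thesis using 2 d u' double_0[OF x] by (auto simp: split_pairing_def)
  next
    case 3
    have "\<tau> x \<in> B" "\<tau> (\<tau> x) = x" using 3 \<tau> x by auto
    then have "x - \<tau> x \<noteq> \<mu>" "x - \<tau> x \<noteq> - \<mu>" using \<mu>(3,4)[of "\<tau> x"] by auto
    then have "\<tau> x - x \<noteq> \<mu>" "\<tau> x - x \<noteq> - \<mu>" by (metis minus_diff_eq minus_minus)+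
    then show ?thesis using d u' 3 by (auto simp: split_pairing_def)
  next
    case 4
    then have "x \<noteq> 0" using zero_BA by auto
    then show ?thesis using 4 d u' double_0[OF x] by (auto simp: split_pairing_def)
  qed
qed

text \<open>The differences determine the edge up to translation in the third coordinate. This is where
  \<open>A \<inter> B = {0}\<close> and the injectivity of \<open>\<tau> x - x\<close> enter.\<close>

lemma split_pairing_diff_inj:
  assumes u: "fst (snd u) \<in> P" and v: "fst (snd v) \<in> P" and c: "c \<noteq> - c"
    and d: "split_pairing B A \<tau> c u - u = split_pairing B A \<tau> c v - v"
  shows "\<exists>b. v = u + (0, 0, b)"
proof -
  obtain e x b where u': "u = (e, x, b)" by (cases u) auto
  obtain f y b' where v': "v = (f, y, b')" by (cases v) auto
  have xy: "x \<in> P" "y \<in> P" using u v u' v' by auto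
  have \<tau>_inj': "x = y" if "x \<in> A" "y \<in> A" "\<tau> x - x = \<tau> y - y"
  proof -
    have "\<tau> (\<tau> x) - \<tau> x = \<tau> (\<tau> y) - \<tau> y"
      using that xy by (simp add: \<tau>(3)) (metis minus_diff_eq)
    then have "\<tau> x = \<tau> y" using \<tau>_inj \<tau>(2) that by blast
    then show ?thesis using \<tau>(3) xy by metis
  qed
  have "e = f \<and> x = y"
  proof (cases e; cases f)
    assume ef: "e = 0" "f = 0"
    have "x = y"
    proof (cases "x \<in> B"; cases "y \<in> B")
      assume "x \<in> B" "y \<in> B"
      then show ?thesis using d \<tau>_inj[of x y] by (simp add: u' v' ef split_pairing_def)
    next
      assume "x \<notin> B" "y \<notin> B"
      then show ?thesis using d double_cancel'[OF xy] by (simp add: u' v' ef split_pairing_def)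
    qed (use d in \<open>simp_all add: u' v' ef split_pairing_def\<close>)
    then show ?thesis using ef by simp
  next
    assume ef: "e = 0" "f = 1"
    have False
    proof (cases "x \<in> B"; cases "y \<in> A")
      assume "x \<notin> B" "y \<notin> A"
      then show ?thesis using d double_cancel'[OF xy] xy BA(1) by (auto simp: u' v' ef split_pairing_def)
    qed (use d c in \<open>simp_all add: u' v' ef split_pairing_def\<close>)
    then show ?thesis ..
  next
    assume ef: "e = 1" "f = 0"
    have False
    proof (cases "x \<in> A"; cases "y \<in> B")
      assume "x \<notin> A" "y \<notin> B"
      then show ?thesis using d double_cancel'[OF xy] xy BA(1) by (auto simp: u' v' ef split_pairing_def)
    qed (use d not_sym[OF c] in \<open>simp_all add: u' v' ef split_pairing_def\<close>)
    then show ?thesis ..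
  next
    assume ef: "e = 1" "f = 1"
    have "x = y"
    proof (cases "x \<in> A"; cases "y \<in> A")
      assume "x \<in> A" "y \<in> A"
      then show ?thesis using d \<tau>_inj' by (simp add: u' v' ef split_pairing_def)
    next
      assume "x \<notin> A" "y \<notin> A"
      then show ?thesis using d double_cancel'[OF xy] by (simp add: u' v' ef split_pairing_def)
    qed (use d in \<open>simp_all add: u' v' ef split_pairing_def\<close>)
    then show ?thesis using ef by simp
  qed
  then have "v = u + (0, 0, b' - b)" by (simp add: u' v')
  then show ?thesis ..
qed

lemma split_pairing_covers:
  assumes "z \<in> P" "z \<noteq> 0"
  shows "\<exists>e x. x \<in> P \<and> split_pairing B A \<tau> c (e, x, 0) - (e, x, 0) = (0, z, 0)"
proof -
  obtain y where y: "y \<in> P" "z = y + y" using odd_subgroup_half[OF P assms(1)] .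
  then have "y \<noteq> 0" using assms(2) by auto
  then have "y \<notin> B \<or> y \<notin> A" using BA by auto
  then show ?thesis
  proof
    assume "y \<notin> B"
    then have "split_pairing B A \<tau> c (0, - y, 0) - (0, - y, 0) = (0, z, 0)"
      using y by (simp add: split_pairing_def uminus_mem)
    then show ?thesis using y closed by blast
  next
    assume "y \<notin> A"
    then have "split_pairing B A \<tau> c (1, - y, 0) - (1, - y, 0) = (0, z, 0)"
      using y by (simp add: split_pairing_def uminus_mem)
    then show ?thesis using y closed by blast
  qed
qed

end

text \<open>All pairs \<open>{x, - x}\<close> are used in level 0 and, reflected at \<open>y\<close> instead of 0, again in level 1.
  The third coordinate is shifted by \<open>\<plusminus> l\<close> with opposite signs in the two levels, so that for
  each nonzero \<open>z \<in> P\<close> both differences \<open>(0, z, l)\<close> and \<open>(0, z, - l)\<close> are realized once. The single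
  edge between the levels joins the two centres 0 and \<open>y\<close>.\<close>

definition twin_pairing ::
    "'a::ab_group_add set \<Rightarrow> 'a \<Rightarrow> 'b::ab_group_add \<Rightarrow> bit \<times> 'a \<times> 'b \<Rightarrow> bit \<times> 'a \<times> 'b" where
  "twin_pairing N y l = (\<lambda>(e, x, b).
     if e = 0 then (if x = 0 then (1, y, b + l) else (0, - x, if x \<in> N then b + l else b - l))
     else (if x = y then (0, 0, b - l) else (1, y + (y - x), if x - y \<in> N then b - l else b + l)))"

context split_odd_group
begin

lemma twin_pairing_closed: "fst (snd u) \<in> P \<Longrightarrow> y \<in> P \<Longrightarrow> fst (snd (twin_pairing N y l u)) \<in> P"
  using closed by (auto simp: twin_pairing_def uminus_mem split: prod.splits if_splits)

lemma N_diff: "x \<in> P \<Longrightarrow> y \<in> P \<Longrightarrow> x \<noteq> y \<Longrightarrow> y - x \<in> N \<longleftrightarrow> x - y \<notin> N"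
  using N[of "x - y"] closed by simp

lemma twin_pairing_invol:
  assumes u: "fst (snd u) \<in> P" and y: "y \<in> P"
  shows "twin_pairing N y l (twin_pairing N y l u) = u"
proof -
  obtain e x b where u': "u = (e, x, b)" by (cases u) auto
  have x: "x \<in> P" using u u' by simp
  show ?thesis
  proof (cases "e = 0")
    case True
    then show ?thesis using N[OF x] by (simp add: u' twin_pairing_def)
  next
    case False
    have "y + (y - x) \<noteq> y" if "x \<noteq> y" using that by simp
    moreover have "y + (y - x) - y = y - x" by simp
    ultimately show ?thesis using False N_diff[OF x y] by (simp add: u' twin_pairing_def)
  qed
qed

lemma twin_pairing_translate:
  "twin_pairing N y l (u + (0, 0, b)) = twin_pairing N y l u + (0, 0, b)"
  by (auto simp: twin_pairing_def algebra_simps split: prod.splits)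

text \<open>With \<open>h\<close> the position relative to the centre of the level, both levels are described by one formula.\<close>

lemma twin_pairing_diff_at:
  assumes "h = (if e = 0 then x else x - y)"
  shows "twin_pairing N y l (e, x, b) - (e, x, b) =
    (if h = 0 then (1, if e = 0 then (y, l) else (- y, - l))
     else (0, - h - h, if (h \<in> N) = (e = 0) then l else - l))"
  using assms by (simp add: twin_pairing_def)

lemma twin_pairing_diff:
  assumes u: "fst (snd u) \<in> P" and y: "y \<in> P" and l: "l \<noteq> 0"
    and d: "twin_pairing N y l u - u = (e, z, w)"
  shows "(e = 0 \<and> z \<noteq> 0 \<and> w \<noteq> 0) \<or> (e = 1 \<and> (z = y \<or> z = - y))"
proof -
  obtain f x b where u': "u = (f, x, b)" by (cases u) auto
  define h where "h = (if f = 0 then x else x - y)"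
  have "h \<in> P" using u u' y closed by (simp add: h_def)
  note d' = d[unfolded u' twin_pairing_diff_at[OF h_def]]
  show ?thesis
  proof (cases "h = 0")
    case True
    then show ?thesis using d' by (auto split: if_splits)
  next
    case False
    then have "e = 0" "z = - h - h" "w = l \<or> w = - l" using d' by (auto split: if_splits)
    then show ?thesis using False l double_0[OF \<open>h \<in> P\<close>] by auto
  qed
qed

lemma twin_pairing_diff_inj:
  assumes u: "fst (snd u) \<in> P" and v: "fst (snd v) \<in> P" and y: "y \<in> P" "y \<noteq> 0"
    and l: "l \<noteq> - l'"
    and d: "twin_pairing N y l u - u = twin_pairing N y l' v - v"
  shows "l' = l \<and> (\<exists>b. v = u + (0, 0, b))"
proof -
  obtain e x b where u': "u = (e, x, b)" by (cases u) auto
  obtain f x' b' where v': "v = (f, x', b')" by (cases v) auto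
  define h where "h = (if e = 0 then x else x - y)"
  define h' where "h' = (if f = 0 then x' else x' - y)"
  have hP: "h \<in> P" "h' \<in> P" using u v u' v' y closed by (simp_all add: h_def h'_def)
  have yy: "y \<noteq> - y" "- y \<noteq> y" using not_self_neg y by force+
  have ll: "l' \<noteq> - l" "- l \<noteq> l'" using l by auto
  note d' = d[unfolded u' v' twin_pairing_diff_at[OF h_def] twin_pairing_diff_at[OF h'_def]]
  have "h = 0 \<longleftrightarrow> h' = 0" using d' by (auto split: if_splits)
  then have hh: "h = h'"
  proof (cases "h = 0")
    case False
    then show ?thesis using d' \<open>h = 0 \<longleftrightarrow> h' = 0\<close> double_cancel'[OF hP] by simp
  qed simp
  have ef: "e = f"
  proof (rule ccontr)
    assume "e \<noteq> f"
    then have "(e = 0) \<noteq> (f = 0)" by (cases e; cases f) auto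
    then show False using d' hh l ll yy by (auto split: if_splits)
  qed
  then have "x = x'" using hh by (simp add: h_def h'_def split: if_splits)
  moreover have "l' = l" using d' hh ef by (cases f) (auto split: if_splits)
  ultimately have "l' = l" "v = u + (0, 0, b' - b)" using ef by (simp_all add: u' v')
  then show ?thesis by blast
qed

lemma twin_pairing_covers:
  assumes "z \<in> P" "z \<noteq> 0" "y \<in> P" "w \<noteq> 0" and l: "l = w \<or> l = - w"
  shows "\<exists>e x. x \<in> P \<and> twin_pairing N y l (e, x, 0) - (e, x, 0) = (0, z, w)"
proof -
  obtain h where h: "h \<in> P" "z = h + h" using odd_subgroup_half[OF P assms(1)] .
  define x where "x = - h"
  have x: "x \<in> P" "x \<noteq> 0" "z = - x - x" using h closed assms by (auto simp: x_def)
  have "twin_pairing N y l (0, x, 0) - (0, x, 0) = (0, z, if x \<in> N then l else - l)"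
    "twin_pairing N y l (1, x + y, 0) - (1, x + y, 0) = (0, z, if x \<in> N then - l else l)"
    using x twin_pairing_diff_at[of x 0 x y l 0] twin_pairing_diff_at[of x 1 "x + y" y l 0] by simp_all
  moreover have "x + y \<in> P" using assms x closed by simp
  moreover have "w = (if x \<in> N then l else - l) \<or> w = (if x \<in> N then - l else l)"
    using l by auto
  ultimately show ?thesis using x(1) by metis
qed

end

definition swap_coords :: "'e \<times> 'a \<times> 'b \<Rightarrow> 'e \<times> 'b \<times> 'a" where
  "swap_coords = (\<lambda>(e, x, b). (e, b, x))"

lemma swap_coords_simps [simp]: "swap_coords (e, x, b) = (e, b, x)"
  by (simp add: swap_coords_def)

lemma swap_swap [simp]: "swap_coords (swap_coords u) = u"
  by (simp add: swap_coords_def split: prod.splits)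

lemma swap_add: "swap_coords (u + v) = swap_coords u + swap_coords v"
  and swap_diff: "swap_coords (u - v) = swap_coords u - swap_coords v"
  by (cases u; cases v; simp)+

lemma swap_proj [simp]: "fst (swap_coords u) = fst u" "fst (snd (swap_coords u)) = snd (snd u)"
  "snd (snd (swap_coords u)) = fst (snd u)"
  by (simp_all add: swap_coords_def split: prod.splits)

text \<open>The differences \<open>(0, z, w)\<close> are those that lie in every subgroup of index two. They are
  divided among three kinds of factors: the split pairing of \<open>P\<close> takes those with \<open>w = 0\<close>, the split
  pairing of \<open>W\<close> those with \<open>z = 0\<close>, and the twin pairings with \<open>l\<close> running through half of
  \<open>W - {0}\<close> take those with \<open>z\<close> and \<open>w\<close> both nonzero. For a fixed nonzero \<open>z\<close> a twin
  pairing takes the differences \<open>(0, z, w)\<close> in pairs \<open>w = \<plusminus> l\<close>, which leaves just \<open>w = 0\<close> for the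
  split pairing of \<open>P\<close>.

  The factors also use some differences \<open>(1, z, w)\<close>, and these must not collide. The
  three kinds are told apart by \<open>w = \<plusminus> \<mu>'\<close> for the first, by \<open>z = \<plusminus> \<nu>\<close> together with \<open>w\<close> of the
  form \<open>\<plusminus> (\<tau>' b - b)\<close>, hence different from \<open>\<plusminus> \<mu>'\<close>, for the second, and by \<open>z = \<plusminus> \<mu>\<close> for
  the third, which is never of the form \<open>\<plusminus> (\<tau> x - x)\<close> and differs from
  \<open>\<plusminus> \<nu>\<close>.\<close>

lemma abelian_one_factorization_two_split_odd_groups:
  fixes P :: "'a::ab_group_add set" and W :: "'b::ab_group_add set"
  assumes "split_odd_group P B A N \<tau> \<mu> \<nu>" "split_odd_group W B' A' N' \<tau>' \<mu>' \<nu>'"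
  shows "\<exists>\<F>. abelian_one_factorization (complete_multipartite (card P * card W) 2) \<F>"
proof -
  interpret P: split_odd_group P B A N \<tau> \<mu> \<nu> by fact
  interpret W: split_odd_group W B' A' N' \<tau>' \<mu>' \<nu>' by fact
  define S where "S = (UNIV :: bit set) \<times> P \<times> W"
  define H where "H = (UNIV :: bit set) \<times> {0::'a} \<times> {0::'b}"
  define L where "L = {l \<in> W. l \<noteq> 0 \<and> l \<in> N'}"
  define s1 where "s1 = split_pairing B A \<tau> \<mu>'"
  define s2 where "s2 = swap_coords \<circ> split_pairing B' A' \<tau>' \<nu> \<circ> swap_coords"
  define tw where "tw l = twin_pairing N \<mu> l" for l :: 'b
  define \<B> where "\<B> = {s1, s2} \<union> tw ` L"
  define \<chi> :: "bit \<times> 'a \<times> 'b \<Rightarrow> bit \<times> 'a \<times> 'b \<Rightarrow> bool" where "\<chi> d u = (fst u = 1)" for d u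
  have S: "add_subgroup S" using P.closed W.closed by (auto simp: add_subgroup_def S_def zero_prod_def)
  have H: "add_subgroup H" by (auto simp: add_subgroup_def H_def zero_prod_def)
  have HS: "H \<subseteq> S" using P.closed W.closed by (auto simp: H_def S_def)
  have U2: "card (UNIV :: bit set) = 2"
  proof -
    have UNIV: "(UNIV :: bit set) = {0, 1}" by (auto intro: bit_not_one_iff[THEN iffD1])
    show ?thesis unfolding UNIV by simp
  qed
  have finU: "finite (UNIV :: bit set)" using U2 by (intro card_ge_0_finite) simp
  have S_iff: "u \<in> S \<longleftrightarrow> fst (snd u) \<in> P \<and> snd (snd u) \<in> W" for u
    by (cases u) (auto simp: S_def)
  have s1_snd: "snd (snd (s1 u)) \<in> W" if "snd (snd u) \<in> W" for u
    using that W.closed W.\<mu>(1) by (auto simp: s1_def split_pairing_def split: prod.splits)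
  have s2_fst: "fst (snd (s2 u)) \<in> P" if "fst (snd u) \<in> P" for u
    using that P.closed P.\<nu>(1)
    by (auto simp: s2_def split_pairing_def swap_coords_def split: prod.splits)
  have tw_snd: "snd (snd (tw l u)) \<in> W" if "snd (snd u) \<in> W" "l \<in> W" for l u
    using that W.closed by (auto simp: tw_def twin_pairing_def split: prod.splits)
  have s1_diff: "(e = 0 \<and> z \<noteq> 0 \<and> w = 0) \<or> (e = 1 \<and> z \<noteq> \<mu> \<and> z \<noteq> - \<mu> \<and> (w = \<mu>' \<or> w = - \<mu>'))"
    if "u \<in> S" "s1 u - u = (e, z, w)" for u e z w
    using P.split_pairing_diff[of u \<mu>' e z w] that by (auto simp: s1_def S_iff)
  have s2_diff: "(e = 0 \<and> w \<noteq> 0 \<and> z = 0) \<or> (e = 1 \<and> w \<noteq> \<mu>' \<and> w \<noteq> - \<mu>' \<and> (z = \<nu> \<or> z = - \<nu>))"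
    if "u \<in> S" "s2 u - u = (e, z, w)" for u e z w
  proof (rule W.split_pairing_diff)
    have "swap_coords (s2 u - u) = (e, w, z)" using that by simp
    then show "split_pairing B' A' \<tau>' \<nu> (swap_coords u) - swap_coords u = (e, w, z)"
      by (simp add: s2_def swap_diff)
  qed (use that in \<open>simp add: S_iff\<close>)
  have tw_diff: "(e = 0 \<and> z \<noteq> 0 \<and> w \<noteq> 0) \<or> (e = 1 \<and> (z = \<mu> \<or> z = - \<mu>))"
    if "u \<in> S" "l \<in> L" "tw l u - u = (e, z, w)" for u l e z w
    using P.twin_pairing_diff[of u \<mu> l e z w] that P.\<mu>(1) by (auto simp: tw_def S_iff L_def)
  have s1_s2: "s1 u - u \<noteq> s2 v - v" if "u \<in> S" "v \<in> S" for u v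
  proof -
    obtain e z w where d: "s1 u - u = (e, z, w)" by (cases "s1 u - u")
    show ?thesis using s1_diff[OF that(1) d] s2_diff[OF that(2), of e z w] d by auto
  qed
  have s1_tw: "s1 u - u \<noteq> tw l v - v" if "u \<in> S" "v \<in> S" "l \<in> L" for u v l
  proof -
    obtain e z w where d: "s1 u - u = (e, z, w)" by (cases "s1 u - u")
    show ?thesis using s1_diff[OF that(1) d] tw_diff[OF that(2,3), of e z w] d by auto
  qed
  have s2_tw: "s2 u - u \<noteq> tw l v - v" if "u \<in> S" "v \<in> S" "l \<in> L" for u v l
  proof -
    obtain e z w where d: "s2 u - u = (e, z, w)" by (cases "s2 u - u")
    have "- \<nu> \<noteq> \<mu>" using P.\<nu>(4) by auto
    then show ?thesis
      using s2_diff[OF that(1) d] tw_diff[OF that(2,3), of e z w] d P.\<nu>(3,4) by auto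
  qed
  have s1_orbit: "s1 (x + (v - u)) = s1 x + (v - u)"
    if "u \<in> S" "v \<in> S" "s1 u - u = s1 v - v" for u v x
  proof -
    have "\<mu>' \<noteq> - \<mu>'" using W.not_self_neg W.\<mu> by blast
    then have "\<exists>b. v = u + (0, 0, b)"
      using P.split_pairing_diff_inj[of u v \<mu>'] that by (auto simp: S_iff s1_def)
    then show ?thesis by (auto simp: s1_def P.split_pairing_translate)
  qed
  have s2_orbit: "s2 (x + (v - u)) = s2 x + (v - u)"
    if "u \<in> S" "v \<in> S" "s2 u - u = s2 v - v" for u v x
  proof -
    have "\<nu> \<noteq> - \<nu>" using P.not_self_neg P.\<nu> by blast
    moreover have "swap_coords (s2 u - u) = swap_coords (s2 v - v)" using that by simp
    ultimately have "\<exists>b. swap_coords v = swap_coords u + (0, 0, b)"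
      using W.split_pairing_diff_inj[of "swap_coords u" "swap_coords v" \<nu>] that
      by (auto simp: S_iff s2_def swap_diff)
    then obtain b where "swap_coords v = swap_coords u + (0, 0, b)" ..
    then have vu: "swap_coords (v - u) = (0, 0, b)" by (simp add: swap_diff)
    then have "v - u = swap_coords (0, 0, b)" by (metis swap_swap)
    then show ?thesis by (simp add: s2_def swap_add W.split_pairing_translate)
  qed
  have tw_orbit: "tw l' (x + (v - u)) = tw l x + (v - u)"
    if "u \<in> S" "v \<in> S" "l \<in> L" "l' \<in> L" "tw l u - u = tw l' v - v" for u v x l l'
  proof -
    have "l \<noteq> - l'" using that W.N[of l'] by (auto simp: L_def)
    then have "l' = l \<and> (\<exists>b. v = u + (0, 0, b))"
      using P.twin_pairing_diff_inj[of u v \<mu> l l'] that P.\<mu> by (auto simp: S_iff tw_def)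
    then show ?thesis by (auto simp: tw_def P.twin_pairing_translate)
  qed
  show ?thesis
  proof (rule abelian_one_factorization_from_starters[OF S H HS, of _ _ \<B> \<chi>])
    show "finite S" by (simp add: S_def finU P.finite_P W.finite_P)
    show "card S = card P * card W * 2" by (simp add: S_def card_cartesian_product U2)
    show "card H = 2" by (simp add: H_def card_cartesian_product U2)
  next
    fix \<sigma> u assume \<sigma>: "\<sigma> \<in> \<B>" and u: "u \<in> S"
    then consider "\<sigma> = s1" | "\<sigma> = s2" | l where "\<sigma> = tw l" "l \<in> L" by (auto simp: \<B>_def)
    then have "\<sigma> u \<in> S \<and> \<sigma> (\<sigma> u) = u \<and> \<sigma> u - u \<notin> H"
    proof cases
      case 1
      have "s1 u - u \<notin> H" using s1_diff[OF u] W.\<mu>(2) by (cases "s1 u - u") (auto simp: H_def)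
      then show ?thesis
        using 1 u s1_snd[of u] P.split_pairing_closed[of u] P.split_pairing_invol[of u] by (simp add: S_iff s1_def)
    next
      case 2
      have "s2 u - u \<notin> H" using s2_diff[OF u] P.\<nu>(2) by (cases "s2 u - u") (auto simp: H_def)
      then show ?thesis
        using 2 u s2_fst[of u] W.split_pairing_closed[of "swap_coords u"]
          W.split_pairing_invol[of "swap_coords u"] by (simp add: S_iff s2_def)
    next
      case 3
      have "tw l u - u \<notin> H" using tw_diff[OF u 3(2)] P.\<mu>(2) by (cases "tw l u - u") (auto simp: H_def)
      then show ?thesis
        using 3 u tw_snd[of u l] P.twin_pairing_closed[of u] P.twin_pairing_invol[of u] P.\<mu>(1)
        by (simp add: S_iff tw_def L_def)
    qed
    then show "\<sigma> u \<in> S" "\<sigma> (\<sigma> u) = u" "\<sigma> u - u \<notin> H" by auto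
  next
    fix \<sigma> \<rho> u v x
    assume st: "\<sigma> \<in> \<B>" "\<rho> \<in> \<B>" and uv: "u \<in> S" "v \<in> S" and eq: "\<sigma> u - u = \<rho> v - v"
    have "\<sigma> = s1 \<or> \<sigma> = s2 \<or> (\<exists>l\<in>L. \<sigma> = tw l)" "\<rho> = s1 \<or> \<rho> = s2 \<or> (\<exists>l\<in>L. \<rho> = tw l)"
      using st by (auto simp: \<B>_def)
    then consider "\<sigma> = s1" "\<rho> = s1" | "\<sigma> = s2" "\<rho> = s2"
      | l l' where "\<sigma> = tw l" "l \<in> L" "\<rho> = tw l'" "l' \<in> L"
      using eq uv s1_s2[of u v] s1_s2[of v u] s1_tw[of u v] s1_tw[of v u] s2_tw[of u v] s2_tw[of v u]
      by metis
    then show "\<rho> (x + (v - u)) = \<sigma> x + (v - u)"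
    proof cases
      case 1
      then show ?thesis using s1_orbit uv eq by blast
    next
      case 2
      then show ?thesis using s2_orbit uv eq by blast
    next
      case 3
      then show ?thesis using tw_orbit[OF uv 3(2,4)] eq by blast
    qed
  next
    fix d assume d: "d \<in> S" "d \<notin> H" "\<forall>\<sigma>\<in>\<B>. \<forall>x\<in>S. \<sigma> x - x \<noteq> d"
    obtain e z w where d': "d = (e, z, w)" by (cases d)
    have zw: "z \<in> P" "w \<in> W" using d d' by (auto simp: S_def)
    have "\<exists>\<sigma>\<in>\<B>. \<exists>x\<in>S. \<sigma> x - x = d" if "e = 0"
    proof -
      consider "w = 0" "z \<noteq> 0" | "w \<noteq> 0" "z = 0" | "w \<noteq> 0" "z \<noteq> 0" using d(2) d' by (auto simp: H_def)
      then show ?thesis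
      proof cases
        case 1
        obtain f x where "x \<in> P" "split_pairing B A \<tau> \<mu>' (f, x, 0) - (f, x, 0) = (0, z, 0)"
          using P.split_pairing_covers[OF zw(1) 1(2)] by blast
        then show ?thesis using 1 d' that W.closed
          by (intro bexI[of _ s1] bexI[of _ "(f, x, 0)"]) (auto simp: s1_def \<B>_def S_def)
      next
        case 2
        obtain f x where x: "x \<in> W" "split_pairing B' A' \<tau>' \<nu> (f, x, 0) - (f, x, 0) = (0, w, 0)"
          using W.split_pairing_covers[OF zw(2) 2(1)] by blast
        have "s2 (f, 0, x) - (f, 0, x) = swap_coords (split_pairing B' A' \<tau>' \<nu> (f, x, 0) - (f, x, 0))"
          by (simp add: s2_def swap_diff)
        also have "\<dots> = d" using x 2 d' that by simp
        finally show ?thesis using x P.closed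
          by (intro bexI[of _ s2] bexI[of _ "(f, 0, x)"]) (auto simp: \<B>_def S_def)
      next
        case 3
        define l where "l = (if w \<in> N' then w else - w)"
        have l: "l \<in> L" "l = w \<or> l = - w" using W.N[OF zw(2) 3(1)] zw 3 W.closed by (auto simp: l_def L_def)
        obtain f x where "x \<in> P" "twin_pairing N \<mu> l (f, x, 0) - (f, x, 0) = (0, z, w)"
          using P.twin_pairing_covers[OF zw(1) 3(2) P.\<mu>(1) 3(1) l(2)] by blast
        then show ?thesis using l d' that W.closed
          by (intro bexI[of _ "tw l"] bexI[of _ "(f, x, 0)"]) (auto simp: tw_def \<B>_def S_def)
      qed
    qed
    then have "e \<noteq> 0" using d(3) by blast
    then have "e = 1" by simp
    moreover have "(a + b = 1) \<longleftrightarrow> ((a = 1) \<noteq> (b = 1))" for a b :: bit by (cases a; cases b) auto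
    ultimately show "\<chi> d d \<and> (\<forall>x\<in>S. \<forall>y\<in>S. \<chi> d (x + y) \<longleftrightarrow> \<chi> d x \<noteq> \<chi> d y) \<and>
        (\<forall>x\<in>S. \<chi> (- d) x = \<chi> d x)"
      by (simp add: \<chi>_def d')
  qed
qed

section \<open>Cyclic groups inside the rationals modulo the integers\<close>

text \<open>The constructions need finite groups whose orders are variables of the statement, so these
  groups have to be subsets of one fixed type. Every finite cyclic group embeds into
  \<open>\<rat> / \<int>\<close>, which is an additive group in the sense of the type classes.\<close>

quotient_type rat_mod_int = rat / "\<lambda>x y :: rat. x - y \<in> \<int>"
proof (rule equivpI)
  show "reflp (\<lambda>x y :: rat. x - y \<in> \<int>)" by (simp add: reflp_def)
  show "symp (\<lambda>x y :: rat. x - y \<in> \<int>)"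
    by (rule sympI) (metis Ints_minus minus_diff_eq)
  show "transp (\<lambda>x y :: rat. x - y \<in> \<int>)"
  proof (rule transpI)
    fix x y z :: rat
    assume "x - y \<in> \<int>" "y - z \<in> \<int>"
    from Ints_add[OF this] show "x - z \<in> \<int>" by simp
  qed
qed

instantiation rat_mod_int :: ab_group_add
begin

lift_definition zero_rat_mod_int :: rat_mod_int is 0 .

lift_definition plus_rat_mod_int :: "rat_mod_int \<Rightarrow> rat_mod_int \<Rightarrow> rat_mod_int" is "(+)"
proof -
  fix a b c d :: rat
  assume "a - b \<in> \<int>" "c - d \<in> \<int>"
  from Ints_add[OF this] show "a + c - (b + d) \<in> \<int>" by (simp add: algebra_simps)
qed

lift_definition minus_rat_mod_int :: "rat_mod_int \<Rightarrow> rat_mod_int \<Rightarrow> rat_mod_int" is "(-)"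
proof -
  fix a b c d :: rat
  assume "a - b \<in> \<int>" "c - d \<in> \<int>"
  from Ints_diff[OF this] show "a - c - (b - d) \<in> \<int>" by (simp add: algebra_simps)
qed

lift_definition uminus_rat_mod_int :: "rat_mod_int \<Rightarrow> rat_mod_int" is uminus
proof -
  fix a b :: rat
  assume "a - b \<in> \<int>"
  from Ints_minus[OF this] show "- a - - b \<in> \<int>" by simp
qed

instance
  by standard (transfer; simp add: algebra_simps)+

end

text \<open>The homomorphism from the integers onto the cyclic subgroup of order \<open>n\<close> that sends 1 to the
  class of \<open>1 / n\<close>.\<close>

lift_definition cyc :: "nat \<Rightarrow> int \<Rightarrow> rat_mod_int" is "\<lambda>n k. of_int k / of_nat n" .

lemma cyc_0 [simp]: "cyc n 0 = 0"
  by transfer simp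

lemma cyc_add: "cyc n (k + l) = cyc n k + cyc n l"
  by transfer (simp add: add_divide_distrib)

lemma cyc_diff: "cyc n (k - l) = cyc n k - cyc n l"
  by transfer (simp add: diff_divide_distrib)

lemma cyc_uminus: "cyc n (- k) = - cyc n k"
  by transfer simp

lemma cyc_eq_iff:
  assumes "n > 0"
  shows "cyc n k = cyc n l \<longleftrightarrow> int n dvd k - l"
  using assms
proof transfer
  fix n k l assume n: "(n::nat) > 0"
  have "(of_int k / of_nat n - of_int l / of_nat n :: rat) = of_int (k - l) / of_int (int n)"
    by (simp add: diff_divide_distrib)
  also have "\<dots> \<in> \<int> \<longleftrightarrow> int n dvd k - l"
  proof
    assume "(of_int (k - l) / of_int (int n) :: rat) \<in> \<int>"
    then obtain q where "(of_int (k - l) / of_int (int n) :: rat) = of_int q" by (auto elim: Ints_cases)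
    then have "(of_int (k - l) :: rat) = of_int (int n * q)" using n by (simp add: field_simps)
    then have "k - l = int n * q" by (simp only: of_int_eq_iff)
    then show "int n dvd k - l" by simp
  next
    assume "int n dvd k - l"
    then obtain q where "k - l = int n * q" by (elim dvdE)
    then have "(of_int (k - l) / of_int (int n) :: rat) = of_int q" using n by simp
    then show "(of_int (k - l) / of_int (int n) :: rat) \<in> \<int>" by simp
  qed
  finally show "(of_int k / of_nat n - of_int l / of_nat n :: rat) \<in> \<int> \<longleftrightarrow> int n dvd k - l" .
qed

definition cyclic_group :: "nat \<Rightarrow> rat_mod_int set" where
  "cyclic_group n = range (cyc n)"

lemma add_subgroup_cyclic: "add_subgroup (cyclic_group n)"
  unfolding add_subgroup_def cyclic_group_def
proof (intro conjI ballI)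
  show "0 \<in> range (cyc n)" by (rule range_eqI[of _ _ 0]) simp
qed (auto simp flip: cyc_diff)

lemma cyclic_group_transversal:
  assumes "n > 0"
  shows "bij_betw (cyc n) {a..<a + int n} (cyclic_group n)"
  unfolding bij_betw_def cyclic_group_def
proof
  show "inj_on (cyc n) {a..<a + int n}"
  proof (rule inj_onI)
    fix k l assume kl: "k \<in> {a..<a + int n}" "l \<in> {a..<a + int n}" "cyc n k = cyc n l"
    then have "int n dvd k - l" using cyc_eq_iff[OF assms] by simp
    moreover have "\<bar>k - l\<bar> < int n" using kl by auto
    ultimately show "k = l" using dvd_imp_le_int[of "k - l" "int n"] by linarith
  qed
  show "cyc n ` {a..<a + int n} = range (cyc n)"
  proof (intro equalityI subsetI)
    fix x assume "x \<in> range (cyc n)"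
    then obtain k where k: "x = cyc n k" by auto
    define l where "l = a + (k - a) mod int n"
    have "k - l = (k - a) - (k - a) mod int n" by (simp add: l_def)
    then have "int n dvd k - l" using dvd_minus_mod[of "int n" "k - a"] by argo
    then have "x = cyc n l" using k cyc_eq_iff[OF assms, of k l] by blast
    moreover have "l \<in> {a..<a + int n}" using assms by (simp add: l_def)
    ultimately show "x \<in> cyc n ` {a..<a + int n}" by blast
  qed auto
qed

lemma card_cyclic: "n > 0 \<Longrightarrow> card (cyclic_group n) = n"
  using bij_betw_same_card[OF cyclic_group_transversal[of n 0]] by simp

lemma odd_subgroup_cyclic:
  assumes "odd n"
  shows "odd_subgroup (cyclic_group n)"
  unfolding odd_subgroup_def
proof (intro conjI ballI impI)
  have n: "n > 0" using assms by (auto intro: odd_pos)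
  show "add_subgroup (cyclic_group n)" by (rule add_subgroup_cyclic)
  show "finite (cyclic_group n)" using card_cyclic[OF n] n by (metis card.infinite less_irrefl)
  fix x assume "x \<in> cyclic_group n" and x: "x + x = 0"
  then obtain k where k: "x = cyc n k" by (auto simp: cyclic_group_def)
  have "cyc n (2 * k) = cyc n 0" using x unfolding mult_2 cyc_add k by simp
  then have "int n dvd 2 * k" unfolding cyc_eq_iff[OF n] by simp
  moreover have "coprime (int n) 2" using assms by simp
  ultimately have "int n dvd k" by (simp add: coprime_dvd_mult_right_iff)
  then show "x = 0" using k cyc_eq_iff[OF n, of k 0] by simp
qed

lemma abelian_one_factorization_even_number_of_parts:
  fixes v d d' :: nat
  assumes "odd d" "odd d'" "v \<ge> 1"
  shows "\<exists>\<F>. abelian_one_factorization (complete_multipartite (2 ^ v * d) (2 * d')) \<F>"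
proof (rule abelian_one_factorization_elementary_times_odd)
  have pos: "d > 0" "d' > 0" using assms by (auto intro: odd_pos)
  show "odd_subgroup (cyclic_group (d * d'))" using assms by (intro odd_subgroup_cyclic) simp
  show "add_subgroup (cyclic_group d')" by (rule add_subgroup_cyclic)
  show "card (cyclic_group (d * d')) = d * d'" "card (cyclic_group d') = d'"
    using pos by (simp_all add: card_cyclic)
  have "cyc d' k = cyc (d * d') (int d * k)" for k
    using pos(1) by transfer simp
  then show "cyclic_group d' \<subseteq> cyclic_group (d * d')" unfolding cyclic_group_def by blast
qed fact

text \<open>Write \<open>q = 4 k + 1\<close> and represent residues by integers of absolute value at most \<open>2 k\<close>. The
  halves consist of the residues of absolute value at most \<open>k\<close> and of the others. The map \<open>\<tau>\<close>
  exchanges \<open>i\<close> with \<open>2 k + 1 - i\<close> for positive \<open>i\<close>, and symmetrically for negative \<open>i\<close>. Its differences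
  on the inner half are 0 and the odd numbers below \<open>2 k\<close> in absolute value. So they are
  distinct, and they miss \<open>\<plusminus> 2\<close>.\<close>

lemma split_odd_group_cyclic:
  fixes q :: nat
  assumes q: "[q = 1] (mod 4)" "q > 1"
  shows "\<exists>B A N \<tau> \<mu> \<nu>. split_odd_group (cyclic_group q) B A N \<tau> \<mu> \<nu>"
proof -
  obtain k :: int where k: "int q = 4 * k + 1" "k \<ge> 1"
  proof -
    have "q mod 4 = 1" using q(1) by (simp add: cong_def)
    then have "q = 4 * (q div 4) + 1" by presburger
    then have "int q = 4 * int (q div 4) + 1" "int (q div 4) \<ge> 1" using q(2) by linarith+
    then show thesis by (rule that)
  qed
  have n: "q > 0" using q by simp
  have "odd (int q)" using k(1) by simp
  then have P: "odd_subgroup (cyclic_group q)" by (intro odd_subgroup_cyclic) simp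
  define e where "e = cyc q"
  have bij: "bij_betw e {- (2 * k)..2 * k} (cyclic_group q)"
  proof -
    have "{- (2 * k)..<- (2 * k) + int q} = {- (2 * k)..2 * k}"
      unfolding k(1) by (simp add: set_eq_iff)
    then show ?thesis using cyclic_group_transversal[OF n, of "- (2 * k)"] by (simp add: e_def)
  qed
  have inj: "i = j" if "e i = e j" "\<bar>i\<bar> \<le> 2 * k" "\<bar>j\<bar> \<le> 2 * k" for i j
  proof (rule inj_onD)
    show "inj_on e {- (2 * k)..2 * k}" using bij by (simp add: bij_betw_def)
    show "i \<in> {- (2 * k)..2 * k}" "j \<in> {- (2 * k)..2 * k}" using that by (simp_all add: abs_le_iff)
  qed fact
  have ex: "\<exists>i. x = e i \<and> \<bar>i\<bar> \<le> 2 * k" if x: "x \<in> cyclic_group q" for x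
  proof -
    have "x \<in> e ` {- (2 * k)..2 * k}" using bij x by (simp add: bij_betw_def)
    then obtain i where "x = e i" "i \<in> {- (2 * k)..2 * k}" by blast
    then have "x = e i \<and> \<bar>i\<bar> \<le> 2 * k" by (simp add: abs_le_iff)
    then show ?thesis ..
  qed
  have e_mem: "e i \<in> cyclic_group q" for i by (simp add: e_def cyclic_group_def)
  have e_uminus: "- e i = e (- i)" and e_diff: "e i - e j = e (i - j)" and e_0: "e 0 = 0" for i j
    by (simp_all add: e_def cyc_uminus cyc_diff)
  define t where "t i = (if i = 0 then 0 else if i > 0 then 2 * k + 1 - i else - (2 * k + 1) - i)" for i
  define \<tau> where "\<tau> x = e (t (THE i. x = e i \<and> \<bar>i\<bar> \<le> 2 * k))" for x
  have \<tau>: "\<tau> (e i) = e (t i)" if "\<bar>i\<bar> \<le> 2 * k" for i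
  proof -
    have "(THE j. e i = e j \<and> \<bar>j\<bar> \<le> 2 * k) = i" using that inj by (intro the_equality conjI) metis+
    then show ?thesis by (simp add: \<tau>_def)
  qed
  have t_0: "t 0 = 0" and t_pos: "\<And>i. i > 0 \<Longrightarrow> t i = 2 * k + 1 - i"
    and t_neg: "\<And>i. i < 0 \<Longrightarrow> t i = - (2 * k + 1) - i"
    by (simp_all add: t_def)
  have t_bound: "\<bar>t i\<bar> \<le> 2 * k" and t_t: "t (t i) = i" if "\<bar>i\<bar> \<le> 2 * k" for i
    using that k(2) by (cases i "0 :: int" rule: linorder_cases; simp add: t_0 t_pos t_neg)+
  have t_odd: "t i - i = 0 \<or> odd (t i - i)" "\<bar>t i - i\<bar> < 2 * k" if "\<bar>i\<bar> \<le> k" for i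
  proof -
    consider "i < 0" | "i = 0" | "i > 0" by linarith
    then have "(t i - i = 0 \<or> odd (t i - i)) \<and> \<bar>t i - i\<bar> < 2 * k"
    proof cases
      case 1
      then have *: "t i - i = 2 * (- k - i) - 1" by (simp add: t_neg)
      show ?thesis unfolding * using 1 that by simp
    next
      case 2
      then show ?thesis using k(2) by (simp add: t_0)
    next
      case 3
      then have *: "t i - i = 2 * (k - i) + 1" by (simp add: t_pos)
      show ?thesis unfolding * using 3 that by simp
    qed
    then show "t i - i = 0 \<or> odd (t i - i)" "\<bar>t i - i\<bar> < 2 * k" by auto
  qed
  define B where "B = e ` {i. \<bar>i\<bar> \<le> k}"
  define A where "A = e ` {i. i = 0 \<or> k < \<bar>i\<bar> \<and> \<bar>i\<bar> \<le> 2 * k}"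
  define N where "N = e ` {1..2 * k}"
  have not_2: "\<tau> x - x \<noteq> e j" if x: "x \<in> B" and j: "j = 2 \<or> j = - 2" for x j
  proof
    assume *: "\<tau> x - x = e j"
    obtain i where i: "x = e i" "\<bar>i\<bar> \<le> k" using x by (auto simp: B_def)
    then have "e (t i - i) = e j" using * \<tau>[of i] k(2) by (simp add: e_diff)
    then have "t i - i = j" using inj[of "t i - i" j] t_odd(2)[OF i(2)] j k(2) by linarith
    then show False using t_odd(1)[OF i(2)] j by (elim disjE) simp_all
  qed
  have "split_odd_group (cyclic_group q) B A N \<tau> (e 2) (e 1)"
  proof
    show "odd_subgroup (cyclic_group q)" by fact
    show "B \<union> A = cyclic_group q"
    proof
      show "B \<union> A \<subseteq> cyclic_group q" using e_mem by (auto simp: B_def A_def)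
      show "cyclic_group q \<subseteq> B \<union> A"
      proof
        fix x assume "x \<in> cyclic_group q"
        then obtain i where "x = e i" "\<bar>i\<bar> \<le> 2 * k" using ex by blast
        then show "x \<in> B \<union> A" unfolding B_def A_def by (cases "\<bar>i\<bar> \<le> k") auto
      qed
    qed
    show "B \<inter> A = {0}"
    proof
      show "{0} \<subseteq> B \<inter> A" using k(2) e_0 by (force simp: B_def A_def)
      show "B \<inter> A \<subseteq> {0}"
      proof
        fix x assume "x \<in> B \<inter> A"
        then have "x \<in> B" "x \<in> A" by auto
        obtain i where i: "x = e i" "\<bar>i\<bar> \<le> k" using \<open>x \<in> B\<close> by (auto simp: B_def)
        obtain j where j: "x = e j" "j = 0 \<or> k < \<bar>j\<bar> \<and> \<bar>j\<bar> \<le> 2 * k"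
          using \<open>x \<in> A\<close> by (auto simp: A_def)
        have "\<bar>i\<bar> \<le> 2 * k" "\<bar>j\<bar> \<le> 2 * k" using i(2) j(2) k(2) by linarith+
        then have "i = j" using inj[of i j] i(1) j(1) by simp
        then have "j = 0" using i(2) j(2) by linarith
        then show "x \<in> {0}" using j(1) e_0 by simp
      qed
    qed
    show "- x \<in> B" if "x \<in> B" for x using that by (auto simp: B_def e_uminus)
    show "- x \<in> A" if "x \<in> A" for x using that by (auto simp: A_def e_uminus)
    show "- x \<in> N \<longleftrightarrow> x \<notin> N" if x: "x \<in> cyclic_group q" "x \<noteq> 0" for x
    proof -
      obtain i where i: "x = e i" "\<bar>i\<bar> \<le> 2 * k" using ex x by blast
      have N: "e j \<in> N \<longleftrightarrow> j > 0" if "\<bar>j\<bar> \<le> 2 * k" for j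
      proof
        assume "e j \<in> N"
        then obtain l where "e j = e l" "l \<in> {1..2 * k}" by (auto simp: N_def)
        then show "j > 0" using inj[of j l] that by auto
      next
        assume "j > 0"
        then show "e j \<in> N" using that by (auto simp: N_def)
      qed
      have "i \<noteq> 0" using i x e_0 by auto
      then show ?thesis using i N[of i] N[of "- i"] by (auto simp: e_uminus)
    qed
    show "\<tau> x \<in> A" if x: "x \<in> B" for x
    proof -
      obtain i where i: "x = e i" "\<bar>i\<bar> \<le> k" using x by (auto simp: B_def)
      have "t i = 0 \<or> k < \<bar>t i\<bar> \<and> \<bar>t i\<bar> \<le> 2 * k"
        using i(2) by (cases i "0 :: int" rule: linorder_cases) (simp_all add: t_0 t_pos t_neg)
      moreover have "\<tau> x = e (t i)" using \<tau>[of i] i k(2) by simp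
      ultimately show ?thesis unfolding A_def by blast
    qed
    show "\<tau> x \<in> B" if x: "x \<in> A" for x
    proof -
      obtain i where i: "x = e i" "i = 0 \<or> k < \<bar>i\<bar> \<and> \<bar>i\<bar> \<le> 2 * k" using x by (auto simp: A_def)
      have "\<bar>t i\<bar> \<le> k"
        using i(2) k(2) by (cases i "0 :: int" rule: linorder_cases) (simp_all add: t_0 t_pos t_neg)
      moreover have "\<tau> x = e (t i)" using \<tau>[of i] i k(2) by auto
      ultimately show ?thesis unfolding B_def by blast
    qed
    show "\<tau> (\<tau> x) = x" if x: "x \<in> cyclic_group q" for x
    proof -
      obtain i where i: "x = e i" "\<bar>i\<bar> \<le> 2 * k" using ex[OF x] by blast
      then show ?thesis using \<tau>[OF i(2)] \<tau>[OF t_bound[OF i(2)]] t_t[OF i(2)] by simp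
    qed
    show "x = y" if xy: "x \<in> B" "y \<in> B" "\<tau> x - x = \<tau> y - y" for x y
    proof -
      have "x \<in> e ` {i. \<bar>i\<bar> \<le> k}" "y \<in> e ` {i. \<bar>i\<bar> \<le> k}" using xy(1,2) by (simp_all add: B_def)
      then obtain i j where ij: "x = e i" "\<bar>i\<bar> \<le> k" "y = e j" "\<bar>j\<bar> \<le> k" by blast
      then have "e (t i - i) = e (t j - j)" using xy(3) \<tau>[of i] \<tau>[of j] k(2) by (simp add: e_diff)
      then have "t i - i = t j - j"
        using inj[of "t i - i" "t j - j"] t_odd(2)[OF ij(2)] t_odd(2)[OF ij(4)] by linarith
      then have "i = j"
        using ij(2,4) by (cases i "0 :: int" rule: linorder_cases; cases j "0 :: int" rule: linorder_cases)
          (simp_all add: t_0 t_pos t_neg, presburger+)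
      then show ?thesis using ij by simp
    qed
    show "e 2 \<in> cyclic_group q" "e 1 \<in> cyclic_group q" by (rule e_mem)+
    show "e 2 \<noteq> 0" "e 1 \<noteq> 0" "e 1 \<noteq> e 2" "e 1 \<noteq> - e 2"
      using inj[of 2 0] inj[of 1 0] inj[of 1 2] inj[of 1 "- 2"] k(2) by (auto simp: e_0 e_uminus)
    show "\<tau> x - x \<noteq> e 2" "\<tau> x - x \<noteq> - e 2" if "x \<in> B" for x
      using not_2[OF that] by (simp_all add: e_uminus)
  qed
  then show ?thesis by blast
qed

lemma abelian_one_factorization_product_1_mod_4:
  fixes a b :: nat
  assumes a: "[a = 1] (mod 4)" "a > 1" and b: "[b = 1] (mod 4)" "b > 1"
  shows "\<exists>\<F>. abelian_one_factorization (complete_multipartite (a * b) 2) \<F>"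
proof -
  obtain B A N \<tau> \<mu> \<nu> where 1: "split_odd_group (cyclic_group a) B A N \<tau> \<mu> \<nu>"
    using split_odd_group_cyclic[OF a] by blast
  obtain B' A' N' \<tau>' \<mu>' \<nu>' where 2: "split_odd_group (cyclic_group b) B' A' N' \<tau>' \<mu>' \<nu>'"
    using split_odd_group_cyclic[OF b] by blast
  have "card (cyclic_group a) = a" "card (cyclic_group b) = b"
    using a(2) b(2) by (simp_all add: card_cyclic)
  then show ?thesis using abelian_one_factorization_two_split_odd_groups[OF 1 2] by simp
qed

section \<open>Nonexistence by counting fixed-point-free involutions\<close>

lemma of_nat_bit_eq_0_iff: "(of_nat n :: bit) = 0 \<longleftrightarrow> even n"
  by (induction n) auto

lemma even_card_fixpoint_free_involution:
  assumes "\<And>x. x \<in> X \<Longrightarrow> h x \<in> X" "\<And>x. x \<in> X \<Longrightarrow> h (h x) = x" "\<And>x. x \<in> X \<Longrightarrow> h x \<noteq> x"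
  shows "even (card X)"
proof -
  have "(\<Sum>x\<in>X. 1 :: bit) = 0"
    by (rule sum_involution_eq_0[where h = h]) (use assms in auto)
  then show ?thesis by (simp add: of_nat_bit_eq_0_iff)
qed

lemma card_split: "finite X \<Longrightarrow> card {x \<in> X. Q x} + card {x \<in> X. \<not> Q x} = card X"
  by (subst card_Un_disjoint[symmetric]) (auto intro: arg_cong[where f = card])

text \<open>The factors are handled through the map \<open>partner F\<close> that sends a vertex to the other end of its
  edge in \<open>F\<close>, and the group through its regular action on the vertices.\<close>

locale abelian_factorized =
  fixes m n :: nat and \<F> :: "(nat \<times> nat) set set set" and G :: "(nat \<times> nat \<Rightarrow> nat \<times> nat) set"
  assumes factorization: "one_factorization (complete_multipartite m n) \<F>"
    and automorphisms: "automorphism_group_of (complete_multipartite m n) \<F> G"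
    and abelian: "comm_group ((BijGroup (fst (complete_multipartite m n)))\<lparr>carrier := G\<rparr>)"
    and sharp: "sharply_transitive_on (fst (complete_multipartite m n)) G"
    and pos: "m > 0" "n > 0"
begin

definition V :: "(nat \<times> nat) set" where "V = {..<m} \<times> {..<n}"

definition A :: "(nat \<times> nat \<Rightarrow> nat \<times> nat) monoid" where "A = (BijGroup V)\<lparr>carrier := G\<rparr>"

definition partner :: "(nat \<times> nat) set set \<Rightarrow> nat \<times> nat \<Rightarrow> nat \<times> nat" where
  "partner F x = (THE y. {x, y} \<in> F)"

definition act :: "(nat \<times> nat \<Rightarrow> nat \<times> nat) \<Rightarrow> (nat \<times> nat) set set \<Rightarrow> (nat \<times> nat) set set" where
  "act g F = (\<lambda>e. g ` e) ` F"

lemma vertices: "fst (complete_multipartite m n) = V"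
  and edges: "snd (complete_multipartite m n) = {{x, y} | x y. x \<in> V \<and> y \<in> V \<and> fst x \<noteq> fst y}"
  by (auto simp: complete_multipartite_def V_def Let_def)

lemma finite_V: "finite V" and card_V: "card V = m * n" and origin: "(0, 0) \<in> V"
  using pos by (auto simp: V_def)

lemma A_comm: "comm_group A"
  using abelian by (simp add: A_def vertices)

sublocale A: comm_group A by (rule A_comm)

lemma G_Bij: "g \<in> G \<Longrightarrow> g \<in> Bij V"
  using automorphisms subgroup.subset unfolding automorphism_group_of_def vertices
  by (fastforce simp: BijGroup_def)

lemma carrier_A [simp]: "carrier A = G"
  by (simp add: A_def)

lemma mult_A: "g \<in> G \<Longrightarrow> h \<in> G \<Longrightarrow> g \<otimes>\<^bsub>A\<^esub> h = compose V g h"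
  using G_Bij by (simp add: A_def BijGroup_def)

lemma one_A: "\<one>\<^bsub>A\<^esub> = (\<lambda>x\<in>V. x)"
  by (simp add: A_def BijGroup_def)

lemma mult_apply: "g \<in> G \<Longrightarrow> h \<in> G \<Longrightarrow> x \<in> V \<Longrightarrow> (g \<otimes>\<^bsub>A\<^esub> h) x = g (h x)"
  by (simp add: mult_A compose_def)

lemma one_apply: "x \<in> V \<Longrightarrow> \<one>\<^bsub>A\<^esub> x = x"
  by (simp add: one_A)

lemma G_closed: "g \<in> G \<Longrightarrow> x \<in> V \<Longrightarrow> g x \<in> V"
  using G_Bij Bij_imp_funcset by blast

lemma inv_apply: "g \<in> G \<Longrightarrow> x \<in> V \<Longrightarrow> (inv\<^bsub>A\<^esub> g) (g x) = x" "g \<in> G \<Longrightarrow> x \<in> V \<Longrightarrow> g ((inv\<^bsub>A\<^esub> g) x) = x"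
  using mult_apply[of "inv\<^bsub>A\<^esub> g" g x] mult_apply[of g "inv\<^bsub>A\<^esub> g" x] A.inv_closed[of g]
    A.l_inv[of g] A.r_inv[of g] one_apply by auto

lemma inv_G [simp]: "g \<in> G \<Longrightarrow> inv\<^bsub>A\<^esub> g \<in> G"
  using A.inv_closed[of g] by simp

lemma mult_G [simp]: "g \<in> G \<Longrightarrow> h \<in> G \<Longrightarrow> g \<otimes>\<^bsub>A\<^esub> h \<in> G"
  using A.m_closed[of g h] by simp

lemma one_G [simp]: "\<one>\<^bsub>A\<^esub> \<in> G"
  using A.one_closed by simp

lemma commute: "g \<in> G \<Longrightarrow> h \<in> G \<Longrightarrow> x \<in> V \<Longrightarrow> g (h x) = h (g x)"
  using A.m_comm[of g h] mult_apply[of g h x] mult_apply[of h g x] by simp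

lemma G_inject: "g x = h x \<Longrightarrow> g \<in> G \<Longrightarrow> h \<in> G \<Longrightarrow> x \<in> V \<Longrightarrow> g = h"
  using sharp G_closed[of g x] unfolding sharply_transitive_on_def vertices by metis

lemma G_transitive: "x \<in> V \<Longrightarrow> y \<in> V \<Longrightarrow> \<exists>g\<in>G. g x = y"
  using sharp unfolding sharply_transitive_on_def vertices by metis

lemma bij_orbit_map: "bij_betw (\<lambda>g. g (0, 0)) G V"
  unfolding bij_betw_def
proof
  show "inj_on (\<lambda>g. g (0, 0)) G" by (rule inj_onI) (use G_inject origin in blast)
  show "(\<lambda>g. g (0, 0)) ` G = V" using G_closed G_transitive origin by blast
qed

lemma finite_G: "finite G" and card_G: "card G = m * n"
  using bij_betw_finite[OF bij_orbit_map] bij_betw_same_card[OF bij_orbit_map] finite_V card_V by auto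

lemma finite_factors: "finite \<F>"
proof -
  have "\<F> \<subseteq> Pow (Pow V)"
    using factorization unfolding one_factorization_def one_factor_def edges by blast
  then show ?thesis using finite_V by (meson finite_Pow_iff finite_subset)
qed

lemma edge_of_factor:
  assumes "F \<in> \<F>" "{x, y} \<in> F"
  shows "x \<in> V" "y \<in> V" "fst x \<noteq> fst y"
proof -
  have "{x, y} \<in> snd (complete_multipartite m n)"
    using assms factorization unfolding one_factorization_def one_factor_def by blast
  then show "x \<in> V" "y \<in> V" "fst x \<noteq> fst y"
    unfolding edges by (auto simp: doubleton_eq_iff)
qed

lemma ex1_partner:
  assumes "F \<in> \<F>" "x \<in> V"
  shows "\<exists>!y. {x, y} \<in> F"
proof -
  have "card {e \<in> F. x \<in> e} = 1"
    using assms factorization unfolding one_factorization_def one_factor_def degree_def vertices by blast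
  then obtain e where e: "{e \<in> F. x \<in> e} = {e}" by (rule card_1_singletonE)
  then have "e \<in> F" "x \<in> e" by auto
  then have "e \<in> snd (complete_multipartite m n)"
    using assms factorization unfolding one_factorization_def one_factor_def by blast
  then obtain y where y: "e = {x, y}" using \<open>x \<in> e\<close> unfolding edges by auto
  show ?thesis
  proof (rule ex1I[of _ y])
    show "{x, y} \<in> F" using y \<open>e \<in> F\<close> by simp
    fix z assume z: "{x, z} \<in> F"
    then have "{x, z} \<in> {e \<in> F. x \<in> e}" by simp
    then have "{x, z} = {x, y}" unfolding e y by (rule singletonD)
    then show "z = y" by (auto simp: doubleton_eq_iff)
  qed
qed

lemma partner_edge: "F \<in> \<F> \<Longrightarrow> x \<in> V \<Longrightarrow> {x, partner F x} \<in> F"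
  unfolding partner_def by (rule theI') (rule ex1_partner)

lemma partner_unique: "F \<in> \<F> \<Longrightarrow> {x, y} \<in> F \<Longrightarrow> partner F x = y"
  using ex1_partner[of F x] partner_edge[of F x] edge_of_factor[of F x y] by blast

lemma partner_V: "F \<in> \<F> \<Longrightarrow> x \<in> V \<Longrightarrow> partner F x \<in> V"
  and partner_part: "F \<in> \<F> \<Longrightarrow> x \<in> V \<Longrightarrow> fst (partner F x) \<noteq> fst x"
  using edge_of_factor[of F x "partner F x"] partner_edge[of F x] by simp_all

lemma partner_partner: "F \<in> \<F> \<Longrightarrow> x \<in> V \<Longrightarrow> partner F (partner F x) = x"
  using partner_edge[of F x] by (intro partner_unique) (simp_all add: insert_commute)

lemma factor_unique:
  assumes "F \<in> \<F>" "F' \<in> \<F>" "x \<in> V" "partner F x = partner F' x"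
  shows "F = F'"
proof (rule ccontr)
  assume "F \<noteq> F'"
  then have "disjnt F F'"
    using assms factorization unfolding one_factorization_def pairwise_def by blast
  then show False
    using partner_edge[OF assms(1,3)] partner_edge[OF assms(2,3)] assms(4) by (auto simp: disjnt_def)
qed

lemma factor_exists:
  assumes "x \<in> V" "y \<in> V" "fst x \<noteq> fst y"
  shows "\<exists>F\<in>\<F>. partner F x = y"
proof -
  have "{x, y} \<in> \<Union>\<F>"
    using assms factorization unfolding one_factorization_def edges by blast
  then show ?thesis using partner_unique by blast
qed

text \<open>Each edge at \<open>x\<close> lies in exactly one factor, so counting factors amounts to counting neighbours.\<close>

lemma bij_factors_neighbours:
  assumes "x \<in> V" "U \<subseteq> V"
  shows "bij_betw (\<lambda>F. partner F x) {F \<in> \<F>. partner F x \<in> U} {y \<in> U. fst y \<noteq> fst x}"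
  unfolding bij_betw_def
proof
  show "inj_on (\<lambda>F. partner F x) {F \<in> \<F>. partner F x \<in> U}"
    using factor_unique assms(1) by (auto simp: inj_on_def)
  show "(\<lambda>F. partner F x) ` {F \<in> \<F>. partner F x \<in> U} = {y \<in> U. fst y \<noteq> fst x}"
  proof (intro equalityI subsetI)
    fix y assume y: "y \<in> {y \<in> U. fst y \<noteq> fst x}"
    then obtain F where "F \<in> \<F>" "partner F x = y" using factor_exists[of x y] assms by auto
    then show "y \<in> (\<lambda>F. partner F x) ` {F \<in> \<F>. partner F x \<in> U}" using y by auto
  next
    fix y assume "y \<in> (\<lambda>F. partner F x) ` {F \<in> \<F>. partner F x \<in> U}"
    then show "y \<in> {y \<in> U. fst y \<noteq> fst x}" using partner_part[OF _ assms(1)] by blast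
  qed
qed

lemma card_factors: "card \<F> = m * n - n"
proof -
  have "{y \<in> V. fst y \<noteq> 0} = V - {0::nat} \<times> {..<n}" by (auto simp: V_def)
  moreover have "{0::nat} \<times> {..<n} \<subseteq> V" using pos by (auto simp: V_def)
  ultimately have "card {y \<in> V. fst y \<noteq> 0} = m * n - n"
    by (simp add: card_Diff_subset card_V card_cartesian_product)
  moreover have "{F \<in> \<F>. partner F (0, 0) \<in> V} = \<F>" using partner_V origin by auto
  ultimately show ?thesis
    using bij_betw_same_card[OF bij_factors_neighbours[OF origin, of V]] by simp
qed

lemma act_factor: "g \<in> G \<Longrightarrow> F \<in> \<F> \<Longrightarrow> act g F \<in> \<F>"
  using automorphisms by (auto simp: automorphism_group_of_def act_def)

lemma act_partner:
  assumes "g \<in> G" "F \<in> \<F>" "x \<in> V"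
  shows "partner (act g F) (g x) = g (partner F x)"
proof (rule partner_unique)
  show "act g F \<in> \<F>" using assms act_factor by simp
  have "g ` {x, partner F x} \<in> act g F" using partner_edge[OF assms(2,3)] unfolding act_def by (rule imageI)
  then show "{g x, g (partner F x)} \<in> act g F" by simp
qed

lemma act_mult:
  assumes "g \<in> G" "h \<in> G" "F \<in> \<F>"
  shows "act (g \<otimes>\<^bsub>A\<^esub> h) F = act g (act h F)"
proof -
  have "(g \<otimes>\<^bsub>A\<^esub> h) ` e = g ` h ` e" if "e \<in> F" for e
  proof -
    have "e \<subseteq> V"
      using that assms factorization unfolding one_factorization_def one_factor_def edges by blast
    then show ?thesis using mult_apply[OF assms(1,2)] unfolding image_image by (intro image_cong) auto
  qed
  then have "act (g \<otimes>\<^bsub>A\<^esub> h) F = (\<lambda>e. g ` h ` e) ` F"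
    unfolding act_def by (rule image_cong[OF refl])
  also have "\<dots> = act g (act h F)" by (simp add: act_def image_image)
  finally show ?thesis .
qed

lemma act_one:
  assumes "F \<in> \<F>"
  shows "act \<one>\<^bsub>A\<^esub> F = F"
proof (rule factor_unique[OF act_factor assms origin])
  show "\<one>\<^bsub>A\<^esub> \<in> G" using A.one_closed by simp
  then show "partner (act \<one>\<^bsub>A\<^esub> F) (0, 0) = partner F (0, 0)"
    using act_partner[of "\<one>\<^bsub>A\<^esub>" F "(0, 0)"] origin assms partner_V by (simp add: one_apply)
qed fact

text \<open>An element of the group maps edges to edges since it permutes the factors; hence it also
  preserves the relation of being in the same part.\<close>

lemma same_part_iff:
  assumes "g \<in> G" "x \<in> V" "y \<in> V"
  shows "fst (g x) = fst (g y) \<longleftrightarrow> fst x = fst y"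
proof -
  have adj: "fst (h u) \<noteq> fst (h v)" if h: "h \<in> G" and uv: "u \<in> V" "v \<in> V" "fst u \<noteq> fst v" for h u v
  proof -
    obtain F where F: "F \<in> \<F>" "partner F u = v" using factor_exists[OF uv] by blast
    then show ?thesis
      using act_partner[OF h F(1) uv(1)] partner_part[OF act_factor[OF h F(1)], of "h u"]
        G_closed[OF h uv(1)] by metis
  qed
  show ?thesis
    using adj[OF assms] adj[of "inv\<^bsub>A\<^esub> g" "g x" "g y"] assms inv_G G_closed inv_apply(1) by metis
qed

text \<open>The stabilizer of a part acts regularly on that part, so it has the even order \<open>n\<close>, and a group
  of even order contains an involution: otherwise inversion would pair off its nontrivial
  elements. Because the group is abelian and transitive, an element that maps one part to itself
  does so with all of them.\<close>

lemma part_preserving_involution: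
  assumes "even n"
  shows "\<exists>j\<in>G. \<forall>x\<in>V. j (j x) = x \<and> j x \<noteq> x \<and> fst (j x) = fst x"
proof -
  define H where "H = {g \<in> G. fst (g (0, 0)) = 0}"
  have "bij_betw (\<lambda>g. g (0, 0)) H ({0::nat} \<times> {..<n})"
    unfolding bij_betw_def
  proof
    show "inj_on (\<lambda>g. g (0, 0)) H" by (rule inj_onI) (use G_inject origin in \<open>auto simp: H_def\<close>)
    show "(\<lambda>g. g (0, 0)) ` H = {0::nat} \<times> {..<n}"
    proof (intro equalityI subsetI)
      fix y assume y: "y \<in> {0::nat} \<times> {..<n}"
      then have "y \<in> V" using pos by (auto simp: V_def)
      then obtain g where "g \<in> G" "g (0, 0) = y" using G_transitive origin by blast
      moreover from this have "g \<in> H" using y by (simp add: H_def mem_Times_iff)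
      ultimately show "y \<in> (\<lambda>g. g (0, 0)) ` H" by blast
    next
      fix y assume "y \<in> (\<lambda>g. g (0, 0)) ` H"
      then obtain g where "g \<in> G" "fst (g (0, 0)) = 0" "y = g (0, 0)" by (auto simp: H_def)
      then show "y \<in> {0::nat} \<times> {..<n}" using G_closed[of g "(0, 0)"] origin by (auto simp: V_def mem_Times_iff)
    qed
  qed
  then have cardH: "card H = n" by (simp add: bij_betw_same_card card_cartesian_product)
  have one: "\<one>\<^bsub>A\<^esub> \<in> H" using A.one_closed origin by (simp add: H_def one_apply)
  have invH: "inv\<^bsub>A\<^esub> g \<in> H" if "g \<in> H" for g
  proof -
    have g: "g \<in> G" "fst (g (0, 0)) = 0" using that by (auto simp: H_def)
    have "fst (g ((inv\<^bsub>A\<^esub> g) (0, 0))) = fst (g (0, 0))" using inv_apply(2)[OF g(1) origin] g(2) by simp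
    then show ?thesis
      using same_part_iff[OF g(1), of "(inv\<^bsub>A\<^esub> g) (0, 0)" "(0, 0)"] g inv_G G_closed origin by (auto simp: H_def)
  qed
  have "\<exists>j\<in>H. j \<noteq> \<one>\<^bsub>A\<^esub> \<and> inv\<^bsub>A\<^esub> j = j"
  proof (rule ccontr)
    assume *: "\<not> ?thesis"
    have "even (card (H - {\<one>\<^bsub>A\<^esub>}))"
    proof (rule even_card_fixpoint_free_involution[where h = "m_inv A"])
      fix g assume g: "g \<in> H - {\<one>\<^bsub>A\<^esub>}"
      then have "g \<in> G" by (simp add: H_def)
      then show "inv\<^bsub>A\<^esub> (inv\<^bsub>A\<^esub> g) = g" by simp
      show "inv\<^bsub>A\<^esub> g \<noteq> g" using g * by blast
      show "inv\<^bsub>A\<^esub> g \<in> H - {\<one>\<^bsub>A\<^esub>}" using g invH A.inv_eq_1_iff[of g] \<open>g \<in> G\<close> by simp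
    qed
    then show False using cardH one assms pos finite_G by (simp add: H_def card_Diff_singleton)
  qed
  then obtain j where j: "j \<in> H" "j \<noteq> \<one>\<^bsub>A\<^esub>" "inv\<^bsub>A\<^esub> j = j" by blast
  have jG: "j \<in> G" "fst (j (0, 0)) = 0" using j(1) by (simp_all add: H_def)
  have "j (j x) = x \<and> j x \<noteq> x \<and> fst (j x) = fst x" if x: "x \<in> V" for x
  proof (intro conjI)
    show "j (j x) = x" using inv_apply(1)[OF jG(1) x] j(3) by simp
    show "j x \<noteq> x" using G_inject[of j x "\<one>\<^bsub>A\<^esub>"] j(2) jG(1) x A.one_closed by (auto simp: one_apply)
    obtain g where g: "g \<in> G" "g (0, 0) = x" using G_transitive origin x by blast
    have "fst (g (j (0, 0))) = fst (g (0, 0))"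
      using same_part_iff[OF g(1), of "j (0, 0)" "(0, 0)"] jG G_closed origin by simp
    then show "fst (j x) = fst x" using commute[OF g(1) jG(1) origin] g(2) by simp
  qed
  then show ?thesis using jG by blast
qed

end

text \<open>The involution \<open>j\<close> has two-point orbits inside the parts. Choosing the lower point of
  each orbit gives a set \<open>V0\<close> that \<open>j\<close> exchanges with its complement and that has an odd number of
  vertices, \<open>d\<close> of them in every part.\<close>

locale abelian_factorized_involution = abelian_factorized +
  fixes j d
  assumes j: "j \<in> G" and j_j: "\<And>x. x \<in> V \<Longrightarrow> j (j x) = x" and j_fix: "\<And>x. x \<in> V \<Longrightarrow> j x \<noteq> x"
    and j_part: "\<And>x. x \<in> V \<Longrightarrow> fst (j x) = fst x"
    and n: "n = 2 * d" and odd: "odd m" "odd d"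
begin

definition V0 :: "(nat \<times> nat) set" where "V0 = {x \<in> V. snd x < snd (j x)}"

lemma V0_V: "x \<in> V0 \<Longrightarrow> x \<in> V" by (simp add: V0_def)

lemma j_V: "x \<in> V \<Longrightarrow> j x \<in> V" using G_closed j by blast

lemma j_V0: "x \<in> V \<Longrightarrow> j x \<in> V0 \<longleftrightarrow> x \<notin> V0"
proof -
  assume x: "x \<in> V"
  have "snd (j x) \<noteq> snd x" using j_fix[OF x] j_part[OF x] by (metis prod.expand)
  then show ?thesis using x j_V[OF x] j_j[OF x] by (auto simp: V0_def)
qed

lemma j_square: "j \<otimes>\<^bsub>A\<^esub> j = \<one>\<^bsub>A\<^esub>"
  by (rule G_inject[of _ "(0, 0)"]) (use j j_j origin in \<open>simp_all add: mult_apply one_apply\<close>)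

lemma inj_j: "X \<subseteq> V \<Longrightarrow> inj_on j X"
  by (rule inj_onI) (metis j_j subsetD)

lemma card_V0_Int:
  assumes "X \<subseteq> V" "\<And>x. x \<in> X \<Longrightarrow> j x \<in> X"
  shows "card X = 2 * card (V0 \<inter> X)"
proof -
  have fin: "finite X" using assms(1) finite_V finite_subset by blast
  have "X = (V0 \<inter> X) \<union> j ` (V0 \<inter> X)"
  proof (intro equalityI subsetI)
    fix x assume x: "x \<in> X"
    show "x \<in> (V0 \<inter> X) \<union> j ` (V0 \<inter> X)"
    proof (cases "x \<in> V0")
      case False
      then have "j x \<in> V0 \<inter> X" using x assms j_V0 by blast
      moreover have "x = j (j x)" using j_j assms x by (metis subsetD)
      ultimately show ?thesis by blast
    qed (use x in simp)
  qed (use assms in auto)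
  moreover have "(V0 \<inter> X) \<inter> j ` (V0 \<inter> X) = {}" using j_V0 V0_V by auto
  moreover have "card (j ` (V0 \<inter> X)) = card (V0 \<inter> X)"
    using inj_j[of "V0 \<inter> X"] assms(1) by (simp add: card_image le_infI2)
  ultimately show ?thesis using fin card_Un_disjoint[of "V0 \<inter> X" "j ` (V0 \<inter> X)"] by simp
qed

lemma card_V0: "card V0 = m * d"
proof -
  have "V0 \<inter> V = V0" using V0_V by auto
  then show ?thesis using card_V0_Int[of V] j_V card_V n by simp
qed

lemma finite_V0: "finite V0" using finite_V by (simp add: V0_def)

lemma card_V0_part:
  assumes "x \<in> V"
  shows "card {y \<in> V0. fst y \<noteq> fst x} = m * d - d"
proof -
  define Q where "Q = {fst x} \<times> {..<n}"
  have Q: "Q \<subseteq> V" using assms by (auto simp: Q_def V_def)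
  have "j y \<in> Q" if "y \<in> Q" for y
    using j_V[of y] j_part[of y] Q that by (auto simp: Q_def V_def mem_Times_iff)
  then have "card (V0 \<inter> Q) = d"
    using card_V0_Int[OF Q] n by (simp add: Q_def card_cartesian_product)
  moreover have "{y \<in> V0. fst y \<noteq> fst x} = V0 - V0 \<inter> Q"
    using V0_V by (auto simp: Q_def V_def)
  ultimately show ?thesis using finite_V0 card_V0 by (simp add: card_Diff_subset)
qed

lemma even_inner: "F \<in> \<F> \<Longrightarrow> even (card {x \<in> V0. partner F x \<in> V0})"
  by (rule even_card_fixpoint_free_involution[where h = "partner F"])
    (use partner_partner partner_part V0_V in force)+

text \<open>The partner map pairs off the vertices of \<open>V0\<close> whose partner is again in \<open>V0\<close>, so an odd number of
  vertices of \<open>V0\<close> have their partner outside. If \<open>j\<close> preserved \<open>F\<close>, then \<open>x \<mapsto> j (partner F x)\<close> would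
  be an involution of this odd set. It has no fixed point because \<open>x\<close> and \<open>j x\<close> are in the
  same part.\<close>

lemma act_j_neq:
  assumes F: "F \<in> \<F>"
  shows "act j F \<noteq> F"
proof
  assume fixed: "act j F = F"
  then have comm: "partner F (j x) = j (partner F x)" if "x \<in> V" for x
    using act_partner[OF j F that] by simp
  have crossing: "even (card {x \<in> V0. partner F x \<notin> V0})"
  proof (rule even_card_fixpoint_free_involution[where h = "\<lambda>x. j (partner F x)"])
    fix x assume "x \<in> {x \<in> V0. partner F x \<notin> V0}"
    then have x: "x \<in> V0" "x \<in> V" "partner F x \<notin> V0" using V0_V by auto
    have p: "partner F x \<in> V" using partner_V[OF F] x by simp
    have "partner F (j (partner F x)) = j x" using comm[OF p] partner_partner[OF F x(2)] by simp
    then show "j (partner F x) \<in> {x \<in> V0. partner F x \<notin> V0}"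
      "j (partner F (j (partner F x))) = x"
      using j_V0[OF p] j_V0[OF x(2)] x j_j by auto
    show "j (partner F x) \<noteq> x"
      using j_part[OF p] partner_part[OF F x(2)] by auto
  qed
  have "even (card V0)"
    unfolding card_split[OF finite_V0, of "\<lambda>x. partner F x \<in> V0", symmetric]
    using crossing even_inner[OF F] by simp
  then show False using card_V0 odd by simp
qed

text \<open>Applying \<open>j\<close> exchanges \<open>V0\<close> with its complement, and a factor has equally many edges inside
  both sets since they have the same size.\<close>

lemma card_inner_act:
  assumes F: "F \<in> \<F>"
  shows "card {x \<in> V0. partner (act j F) x \<in> V0} = card {x \<in> V0. partner F x \<in> V0}"
proof -
  let ?W = "V - V0"
  have "bij_betw j {y \<in> ?W. partner F y \<in> ?W} {x \<in> V0. partner (act j F) x \<in> V0}"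
  proof (rule bij_betw_byWitness[where f' = j])
    show "j ` {y \<in> ?W. partner F y \<in> ?W} \<subseteq> {x \<in> V0. partner (act j F) x \<in> V0}"
    proof
      fix x assume "x \<in> j ` {y \<in> ?W. partner F y \<in> ?W}"
      then obtain y where y: "x = j y" "y \<in> V" "y \<notin> V0" "partner F y \<in> V" "partner F y \<notin> V0" by blast
      then show "x \<in> {x \<in> V0. partner (act j F) x \<in> V0}"
        using j_V0[OF y(2)] j_V0[OF y(4)] act_partner[OF j F y(2)] by simp
    qed
    show "j ` {x \<in> V0. partner (act j F) x \<in> V0} \<subseteq> {y \<in> ?W. partner F y \<in> ?W}"
    proof
      fix y assume "y \<in> j ` {x \<in> V0. partner (act j F) x \<in> V0}"
      then obtain x where x: "y = j x" "x \<in> V0" "partner (act j F) x \<in> V0" by auto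
      have y: "y \<in> V" "y \<notin> V0" "x = j y"
        using x(1) j_V[OF V0_V[OF x(2)]] j_V0[OF V0_V[OF x(2)]] j_j[OF V0_V[OF x(2)]] x(2) by simp_all
      have "j (partner F y) \<in> V0" using act_partner[OF j F y(1)] x(3) unfolding y(3) by simp
      then show "y \<in> {y \<in> ?W. partner F y \<in> ?W}"
        using j_V0[OF partner_V[OF F y(1)]] partner_V[OF F y(1)] y(1,2) by simp
    qed
  qed (use j_j V0_V in auto)
  then have "card {x \<in> V0. partner (act j F) x \<in> V0} = card {y \<in> ?W. partner F y \<in> ?W}"
    by (simp add: bij_betw_same_card)
  moreover have "card {y \<in> ?W. partner F y \<in> ?W} + card {y \<in> ?W. partner F y \<in> V0} = card ?W"
  proof -
    have "{y \<in> ?W. partner F y \<in> V0} = {y \<in> ?W. \<not> partner F y \<in> ?W}" using partner_V[OF F] by blast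
    then show ?thesis using card_split[of ?W "\<lambda>y. partner F y \<in> ?W"] finite_V by simp
  qed
  moreover have "card {x \<in> V0. partner F x \<in> V0} + card {x \<in> V0. partner F x \<in> ?W} = card V0"
  proof -
    have "{x \<in> V0. partner F x \<in> ?W} = {x \<in> V0. partner F x \<notin> V0}"
      using partner_V[OF F] V0_V by blast
    then show ?thesis using card_split[OF finite_V0, of "\<lambda>x. partner F x \<in> V0"] by simp
  qed
  moreover have "bij_betw (partner F) {y \<in> ?W. partner F y \<in> V0} {x \<in> V0. partner F x \<in> ?W}"
    by (rule bij_betw_byWitness[where f' = "partner F"])
      (use partner_partner[OF F] V0_V in auto)
  then have "card {y \<in> ?W. partner F y \<in> V0} = card {x \<in> V0. partner F x \<in> ?W}"
    by (rule bij_betw_same_card)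
  moreover have "card ?W = card V0"
    using card_V0 card_V n finite_V0 V0_V by (subst card_Diff_subset) auto
  ultimately show ?thesis by linarith
qed

text \<open>The number of ordered adjacent pairs inside \<open>V0\<close> is the sum over all factors \<open>F\<close> of the number of
  vertices of \<open>V0\<close> with partner in \<open>V0\<close>. Every summand is even, and equal summands occur in pairs
  because \<open>F\<close> and \<open>act j F\<close> are different.\<close>

lemma four_dvd: "4 dvd m * d * (m * d - d)"
proof -
  define f where "f F = card {x \<in> V0. partner F x \<in> V0}" for F
  have "(\<Sum>F\<in>\<F>. of_nat (f F div 2) :: bit) = 0"
  proof (rule sum_involution_eq_0[where h = "act j"])
    fix F assume F: "F \<in> \<F>"
    show "of_nat (f (act j F) div 2) + (of_nat (f F div 2) :: bit) = 0"
      using card_inner_act[OF F] by (cases "of_nat (f F div 2) :: bit") (auto simp: f_def)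
    show "act j F \<in> \<F>" using act_factor j F by simp
    show "act j F \<noteq> F" using act_j_neq F by simp
    show "act j (act j F) = F" using act_mult[OF j j F] act_one[OF F] j_square by simp
  qed
  then have "even (\<Sum>F\<in>\<F>. f F div 2)" by (simp add: of_nat_bit_eq_0_iff flip: of_nat_sum)
  then have "4 dvd 2 * (\<Sum>F\<in>\<F>. f F div 2)" by auto
  also have "2 * (\<Sum>F\<in>\<F>. f F div 2) = (\<Sum>F\<in>\<F>. f F)"
    unfolding sum_distrib_left using even_inner by (intro sum.cong) (auto simp: f_def)
  also have "\<dots> = (\<Sum>F\<in>\<F>. \<Sum>x\<in>V0. if partner F x \<in> V0 then 1 else 0)"
    using finite_V0 by (simp add: f_def sum.If_cases Int_def)
  also have "\<dots> = (\<Sum>x\<in>V0. \<Sum>F\<in>\<F>. if partner F x \<in> V0 then 1 else 0)"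
    by (rule sum.swap)
  also have "\<dots> = (\<Sum>x\<in>V0. card {F \<in> \<F>. partner F x \<in> V0})"
    using finite_factors by (simp add: sum.If_cases Int_def)
  also have "\<dots> = (\<Sum>x\<in>V0. m * d - d)"
  proof (rule sum.cong)
    fix x assume "x \<in> V0"
    then have x: "x \<in> V" by (rule V0_V)
    have "V0 \<subseteq> V" using V0_V by blast
    from bij_betw_same_card[OF bij_factors_neighbours[OF x this]]
    show "card {F \<in> \<F>. partner F x \<in> V0} = m * d - d" using card_V0_part[OF x] by simp
  qed simp
  finally show ?thesis by (simp add: card_V0)
qed

end

lemma no_abelian_one_factorization_3_mod_4:
  fixes m d :: nat
  assumes m: "[m = 3] (mod 4)" and d: "odd d"
  shows "\<not> abelian_one_factorization (complete_multipartite m (2 * d)) \<F>"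
proof
  assume "abelian_one_factorization (complete_multipartite m (2 * d)) \<F>"
  then obtain G where G: "one_factorization (complete_multipartite m (2 * d)) \<F>"
    "automorphism_group_of (complete_multipartite m (2 * d)) \<F> G"
    "comm_group ((BijGroup (fst (complete_multipartite m (2 * d))))\<lparr>carrier := G\<rparr>)"
    "sharply_transitive_on (fst (complete_multipartite m (2 * d))) G"
    by (auto simp: abelian_one_factorization_def)
  have "m mod 4 = 3" using m by (simp add: cong_def)
  then obtain q where q: "m = 4 * q + 3" by (metis mult_div_mod_eq)
  interpret abelian_factorized m "2 * d" \<F> G
    by (rule abelian_factorized.intro) (use G q odd_pos[OF d] in simp_all)
  obtain j where "j \<in> G" "\<forall>x\<in>V. j (j x) = x \<and> j x \<noteq> x \<and> fst (j x) = fst x"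
    using part_preserving_involution by auto
  then interpret abelian_factorized_involution m "2 * d" \<F> G j d
    by (intro abelian_factorized_involution.intro abelian_factorized_involution_axioms.intro
        abelian_factorized_axioms) (use q d in simp_all)
  have "m * d * (m * d - d) = 2 * (m * d * d * (2 * q + 1))"
    by (simp add: q algebra_simps)
  then have "2 * 2 dvd 2 * (m * d * d * (2 * q + 1))" using four_dvd by simp
  then have "2 dvd m * d * d * (2 * q + 1)" by (metis nat_mult_dvd_cancel_disj zero_neq_numeral)
  then show False using odd by simp
qed

text \<open>There are only \<open>2 p - 2\<close> factors, fewer than the \<open>2 p\<close> group elements, so each factor has a
  nontrivial stabilizer. It does not contain \<open>j\<close>, and together with \<open>j\<close> it generates a subgroup
  of twice its order, which divides \<open>2 p\<close>; so the order of the stabilizer is \<open>p\<close>. Now let \<open>h \<noteq> 1\<close> stabilize some factor. Then \<open>x\<close> and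
  \<open>h x\<close> lie in different parts, and the factor containing the edge \<open>{x, h x}\<close> cannot be
  stabilized by \<open>h\<close>: it would also contain \<open>{h x, h (h x)}\<close>, and \<open>h (h x) \<noteq> x\<close> since the order of \<open>h\<close> is
  odd. So there are two
  different subgroups of the prime order \<open>p\<close>. They meet trivially, and their product
  has \<open>p ^ 2 > 2 p\<close> elements.\<close>

lemma no_abelian_one_factorization_prime:
  fixes p :: nat
  assumes p: "Factorial_Ring.prime p" "odd p"
  shows "\<not> abelian_one_factorization (complete_multipartite p 2) \<F>"
proof
  assume "abelian_one_factorization (complete_multipartite p 2) \<F>"
  then obtain G where G: "one_factorization (complete_multipartite p 2) \<F>"
    "automorphism_group_of (complete_multipartite p 2) \<F> G"
    "comm_group ((BijGroup (fst (complete_multipartite p 2)))\<lparr>carrier := G\<rparr>)"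
    "sharply_transitive_on (fst (complete_multipartite p 2)) G"
    by (auto simp: abelian_one_factorization_def)
  interpret abelian_factorized p 2 \<F> G
    by (rule abelian_factorized.intro) (use G odd_pos[OF p(2)] in simp_all)
  obtain j where "j \<in> G" "\<forall>x\<in>V. j (j x) = x \<and> j x \<noteq> x \<and> fst (j x) = fst x"
    using part_preserving_involution by auto
  then interpret abelian_factorized_involution p 2 \<F> G j 1
    by (intro abelian_factorized_involution.intro abelian_factorized_involution_axioms.intro
        abelian_factorized_axioms) (use p in simp_all)
  define L where "L F = {g \<in> G. act g F = F}" for F
  have L_sub: "subgroup (L F) A" if F: "F \<in> \<F>" for F
  proof (rule A.subgroupI)
    show "L F \<subseteq> carrier A" by (auto simp: L_def)
    show "L F \<noteq> {}" using act_one[OF F] one_G by (auto simp: L_def simp del: one_G)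
    fix g assume g: "g \<in> L F"
    then have "act (inv\<^bsub>A\<^esub> g \<otimes>\<^bsub>A\<^esub> g) F = act (inv\<^bsub>A\<^esub> g) F"
      using act_mult[of "inv\<^bsub>A\<^esub> g" g F] inv_G F by (simp add: L_def)
    then show "inv\<^bsub>A\<^esub> g \<in> L F" using g inv_G act_one[OF F] by (simp add: L_def)
    fix h assume "h \<in> L F"
    then show "g \<otimes>\<^bsub>A\<^esub> h \<in> L F" using g act_mult[of g h F] F A.m_closed[of g h] by (simp add: L_def)
  qed
  have card_L: "card (L F) = p" if F: "F \<in> \<F>" for F
  proof -
    have finL: "finite (L F)" using finite_G by (simp add: L_def)
    interpret L: subgroup "L F" A by (rule L_sub[OF F])
    have "\<not> inj_on (\<lambda>g. act g F) G"
    proof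
      assume "inj_on (\<lambda>g. act g F) G"
      then have "card G \<le> card \<F>"
        using act_factor F finite_factors by (intro card_inj_on_le[where f = "\<lambda>g. act g F"]) auto
      then show False using card_G card_factors pos by simp
    qed
    then obtain g h where gh: "g \<in> G" "h \<in> G" "g \<noteq> h" "act g F = act h F" by (auto simp: inj_on_def)
    have "act (inv\<^bsub>A\<^esub> h \<otimes>\<^bsub>A\<^esub> g) F = F"
      using act_mult[of "inv\<^bsub>A\<^esub> h" g F] act_mult[of "inv\<^bsub>A\<^esub> h" h F] gh inv_G F act_one[OF F] by simp
    then have "inv\<^bsub>A\<^esub> h \<otimes>\<^bsub>A\<^esub> g \<in> L F" using gh by (simp add: L_def)
    moreover have "inv\<^bsub>A\<^esub> h \<otimes>\<^bsub>A\<^esub> g \<noteq> \<one>\<^bsub>A\<^esub>"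
      using gh by (metis A.inv_closed A.inv_equality A.inv_inv carrier_A)
    ultimately have "card (L F) \<noteq> 1" using L.one_closed by (metis card_1_singletonE singletonD)
    have j_notin: "j \<notin> L F" using act_j_neq[OF F] by (simp add: L_def)
    have LG: "g \<in> G" if "g \<in> L F" for g using that by (simp add: L_def)
    \<comment> \<open>The theorem of Lagrange for the subgroup generated by the stabilizer and \<open>j\<close> bounds the stabilizer.\<close>
    define K where "K = L F \<union> (\<otimes>\<^bsub>A\<^esub>) j ` L F"
    have KI: "g \<in> K" "j \<otimes>\<^bsub>A\<^esub> g \<in> K" if "g \<in> L F" for g using that by (auto simp: K_def)
    have "subgroup K A"
    proof (rule A.subgroupI)
      show "K \<subseteq> carrier A" using LG A.m_closed j by (auto simp: K_def)
      show "K \<noteq> {}" using KI(1)[OF L.one_closed] by blast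
      fix g assume "g \<in> K"
      then obtain g' where g': "g' \<in> L F" "g = g' \<or> g = j \<otimes>\<^bsub>A\<^esub> g'" by (auto simp: K_def)
      have "inv\<^bsub>A\<^esub> (j \<otimes>\<^bsub>A\<^esub> g') = j \<otimes>\<^bsub>A\<^esub> inv\<^bsub>A\<^esub> g'"
        using A.inv_mult[of j g'] A.inv_equality[OF j_square] j LG[OF g'(1)] by simp
      then show "inv\<^bsub>A\<^esub> g \<in> K" using g' KI L.m_inv_closed by auto
      fix h assume "h \<in> K"
      then obtain h' where h': "h' \<in> L F" "h = h' \<or> h = j \<otimes>\<^bsub>A\<^esub> h'" by (auto simp: K_def)
      note GG = LG[OF g'(1)] LG[OF h'(1)] j
      have "j \<otimes>\<^bsub>A\<^esub> g' \<otimes>\<^bsub>A\<^esub> (j \<otimes>\<^bsub>A\<^esub> h') = (j \<otimes>\<^bsub>A\<^esub> j) \<otimes>\<^bsub>A\<^esub> (g' \<otimes>\<^bsub>A\<^esub> h')"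
        using GG by (simp add: A.m_ac)
      also have "\<dots> = g' \<otimes>\<^bsub>A\<^esub> h'" using GG A.m_closed[of g' h'] by (simp add: j_square)
      finally have "j \<otimes>\<^bsub>A\<^esub> g' \<otimes>\<^bsub>A\<^esub> (j \<otimes>\<^bsub>A\<^esub> h') = g' \<otimes>\<^bsub>A\<^esub> h'" .
      moreover have "j \<otimes>\<^bsub>A\<^esub> g' \<otimes>\<^bsub>A\<^esub> h' = j \<otimes>\<^bsub>A\<^esub> (g' \<otimes>\<^bsub>A\<^esub> h')"
        "g' \<otimes>\<^bsub>A\<^esub> (j \<otimes>\<^bsub>A\<^esub> h') = j \<otimes>\<^bsub>A\<^esub> (g' \<otimes>\<^bsub>A\<^esub> h')"
        using GG by (simp_all add: A.m_ac)
      ultimately show "g \<otimes>\<^bsub>A\<^esub> h \<in> K"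
        using g'(2) h'(2) KI[OF L.m_closed[OF g'(1) h'(1)]] by auto
    qed
    then have "card K dvd 2 * p"
      using A.lagrange[of K] card_G by (metis dvd_triv_right carrier_A order_def mult.commute)
    moreover have "card K = 2 * card (L F)"
    proof -
      have "inj_on ((\<otimes>\<^bsub>A\<^esub>) j) (L F)"
        by (rule inj_onI) (use LG j in simp)
      moreover have "L F \<inter> (\<otimes>\<^bsub>A\<^esub>) j ` L F = {}"
      proof -
        have False if "g \<in> L F" "j \<otimes>\<^bsub>A\<^esub> g \<in> L F" for g
        proof -
          have "j \<otimes>\<^bsub>A\<^esub> g \<otimes>\<^bsub>A\<^esub> inv\<^bsub>A\<^esub> g = j" using j LG[OF that(1)] inv_G by (simp add: A.m_assoc)
          then show False using L.m_closed[OF that(2) L.m_inv_closed[OF that(1)]] j_notin by simp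
        qed
        then show ?thesis by blast
      qed
      ultimately show ?thesis using finL by (simp add: K_def card_Un_disjoint card_image)
    qed
    ultimately have "card (L F) dvd p" by simp
    then show ?thesis using p(1) \<open>card (L F) \<noteq> 1\<close> by (auto simp: prime_nat_iff)
  qed
  have p3: "p \<ge> 3" using p prime_ge_2_nat[OF p(1)] by (cases "p = 2") auto
  have "(1, 0) \<in> V" using p3 by (simp add: V_def)
  then obtain F where F: "F \<in> \<F>" using factor_exists[of "(0, 0)" "(1, 0)"] origin by auto
  have "\<exists>h\<in>L F. h \<noteq> \<one>\<^bsub>A\<^esub>"
  proof (rule ccontr)
    assume "\<not> ?thesis"
    then have "L F \<subseteq> {\<one>\<^bsub>A\<^esub>}" by blast
    then have "card (L F) \<le> 1" using card_mono[of "{\<one>\<^bsub>A\<^esub>}" "L F"] by simp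
    then show False using card_L[OF F] p3 by simp
  qed
  then obtain h where h: "h \<in> L F" "h \<noteq> \<one>\<^bsub>A\<^esub>" by blast
  have hG: "h \<in> G" using h by (simp add: L_def)
  have "h \<noteq> j" using h act_j_neq[OF F] by (auto simp: L_def)
  then have "h (0, 0) \<noteq> j (0, 0)" using G_inject hG j origin by blast
  moreover have "h (0, 0) \<noteq> (0, 0)"
    using G_inject[of h "(0, 0)" "\<one>\<^bsub>A\<^esub>"] h hG origin A.one_closed by (auto simp: one_apply)
  moreover have "fst (j (0, 0)) = 0" "j (0, 0) \<noteq> (0, 0)" "j (0, 0) \<in> V" "h (0, 0) \<in> V"
    using j_part j_fix j_V G_closed hG origin by force+
  ultimately have "fst (h (0, 0)) \<noteq> 0" by (cases "h (0, 0)"; cases "j (0, 0)") (auto simp: V_def)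
  then obtain F' where F': "F' \<in> \<F>" "partner F' (0, 0) = h (0, 0)"
    using factor_exists[of "(0, 0)" "h (0, 0)"] origin G_closed[OF hG origin] by auto
  have "h \<notin> L F'"
  proof
    assume "h \<in> L F'"
    then have "act h F' = F'" by (simp add: L_def)
    then have "h (h (0, 0)) = (0, 0)"
      using act_partner[OF hG F'(1) origin] partner_partner[OF F'(1) origin] F'(2) by simp
    then have hh: "h \<otimes>\<^bsub>A\<^esub> h = \<one>\<^bsub>A\<^esub>"
      using G_inject[of "h \<otimes>\<^bsub>A\<^esub> h" "(0, 0)" "\<one>\<^bsub>A\<^esub>"] A.m_closed[of h h] A.one_closed hG origin
      by (simp add: mult_apply one_apply)
    interpret L: subgroup "L F" A by (rule L_sub[OF F])
    have "even (card (L F))"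
    proof (rule even_card_fixpoint_free_involution[where h = "(\<otimes>\<^bsub>A\<^esub>) h"])
      fix g assume g: "g \<in> L F"
      then have gG: "g \<in> G" by (simp add: L_def)
      show "h \<otimes>\<^bsub>A\<^esub> g \<in> L F" using h g by simp
      show "h \<otimes>\<^bsub>A\<^esub> (h \<otimes>\<^bsub>A\<^esub> g) = g" using hh hG gG by (simp flip: A.m_assoc)
      show "h \<otimes>\<^bsub>A\<^esub> g \<noteq> g" using h(2) hG gG A.r_cancel_one[of g h] by simp
    qed
    then show False using card_L[OF F] p by simp
  qed
  interpret L: subgroup "L F" A by (rule L_sub[OF F])
  interpret L': subgroup "L F'" A by (rule L_sub[OF F'(1)])
  have trivial: "L F \<inter> L F' = {\<one>\<^bsub>A\<^esub>}"
  proof -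
    have "subgroup (L F \<inter> L F') A" using L_sub F F' A.subgroups_Inter_pair by blast
    then have "subgroup (L F \<inter> L F') (A\<lparr>carrier := L F\<rparr>)"
      using A.subgroup_incl[OF _ L_sub[OF F]] by simp
    then have "card (rcosets\<^bsub>A\<lparr>carrier := L F\<rparr>\<^esub> (L F \<inter> L F')) * card (L F \<inter> L F') = card (L F)"
      using group.lagrange[OF A.subgroup_imp_group[OF L_sub[OF F]]] by (simp add: order_def)
    then have "card (L F \<inter> L F') dvd p" unfolding card_L[OF F] by (metis dvd_triv_right)
    moreover have "card (L F \<inter> L F') < p"
    proof -
      have "finite (L F)" using finite_G by (simp add: L_def)
      moreover have "L F \<inter> L F' \<subset> L F" using h(1) \<open>h \<notin> L F'\<close> by blast
      ultimately show ?thesis using psubset_card_mono card_L[OF F] by metis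
    qed
    ultimately have "card (L F \<inter> L F') = 1" using p(1) by (auto simp: prime_nat_iff)
    then obtain a where "L F \<inter> L F' = {a}" by (rule card_1_singletonE)
    then show ?thesis using L.one_closed L'.one_closed by auto
  qed
  have "inj_on (\<lambda>(a, b). a \<otimes>\<^bsub>A\<^esub> b) (L F \<times> L F')"
  proof (rule inj_onI, clarify)
    fix a b a' b'
    assume ab: "a \<in> L F" "b \<in> L F'" "a' \<in> L F" "b' \<in> L F'" "a \<otimes>\<^bsub>A\<^esub> b = a' \<otimes>\<^bsub>A\<^esub> b'"
    have G: "a \<in> G" "b \<in> G" "a' \<in> G" "b' \<in> G" using ab by (simp_all add: L_def)
    note iG = inv_G[OF G(1)] inv_G[OF G(2)] inv_G[OF G(3)] inv_G[OF G(4)]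
    have "inv\<^bsub>A\<^esub> a' \<otimes>\<^bsub>A\<^esub> a = inv\<^bsub>A\<^esub> a' \<otimes>\<^bsub>A\<^esub> (a \<otimes>\<^bsub>A\<^esub> b) \<otimes>\<^bsub>A\<^esub> inv\<^bsub>A\<^esub> b"
      using G iG by (simp add: A.m_assoc)
    also have "\<dots> = b' \<otimes>\<^bsub>A\<^esub> inv\<^bsub>A\<^esub> b"
      unfolding ab(5) using G iG by (simp flip: A.m_assoc)
    finally have eq: "inv\<^bsub>A\<^esub> a' \<otimes>\<^bsub>A\<^esub> a = b' \<otimes>\<^bsub>A\<^esub> inv\<^bsub>A\<^esub> b" .
    have "inv\<^bsub>A\<^esub> a' \<otimes>\<^bsub>A\<^esub> a \<in> L F" "b' \<otimes>\<^bsub>A\<^esub> inv\<^bsub>A\<^esub> b \<in> L F'"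
      using ab L.m_closed L.m_inv_closed L'.m_closed L'.m_inv_closed by auto
    then have "inv\<^bsub>A\<^esub> a' \<otimes>\<^bsub>A\<^esub> a = \<one>\<^bsub>A\<^esub>" using eq trivial by auto
    then have "inv\<^bsub>A\<^esub> a = inv\<^bsub>A\<^esub> a'" using A.inv_equality[of "inv\<^bsub>A\<^esub> a'" a] G iG by simp
    then have "inv\<^bsub>A\<^esub> (inv\<^bsub>A\<^esub> a) = inv\<^bsub>A\<^esub> (inv\<^bsub>A\<^esub> a')" by (rule arg_cong)
    then have "a = a'" using G by simp
    then show "a = a' \<and> b = b'" using ab(5) G by simp
  qed
  then have "card (L F \<times> L F') \<le> card G"
    using A.m_closed finite_G by (intro card_inj_on_le) (auto simp: L_def)
  then have "p * p \<le> p * 2" using card_L F F'(1) by (simp add: card_cartesian_product card_G)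
  then show False using p3 by simp
qed

section \<open>Existence and nonexistence for complete multipartite graphs\<close>

theorem theorem3:
  shows
    "(\<forall>m n v d d' :: nat. m = 2 ^ v * d \<and> n = 2 * d' \<and> odd d \<and> odd d' \<and> v \<ge> 2 \<longrightarrow>
        (\<exists>\<F>. abelian_one_factorization (complete_multipartite m n) \<F>)) \<and>
     (\<forall>m n p :: nat. m = p \<and> n = 2 \<and> Factorial_Ring.prime p \<and> [p = 1] (mod 4) \<longrightarrow>
        \<not> (\<exists>\<F>. abelian_one_factorization (complete_multipartite m n) \<F>)) \<and>
     (\<forall>m n p v :: nat. m = p ^ v \<and> n = 2 \<and> Factorial_Ring.prime p \<and> [p = 1] (mod 4) \<and> v \<ge> 2 \<longrightarrow>
        (\<exists>\<F>. abelian_one_factorization (complete_multipartite m n) \<F>)) \<and>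
     (\<forall>m n d :: nat. [m = 3] (mod 4) \<and> n = 2 * d \<and> odd d \<longrightarrow>
        \<not> (\<exists>\<F>. abelian_one_factorization (complete_multipartite m n) \<F>))"
proof (intro conjI allI impI)
  fix m n v d d' :: nat
  assume *: "m = 2 ^ v * d \<and> n = 2 * d' \<and> odd d \<and> odd d' \<and> v \<ge> 2"
  have "\<exists>\<F>. abelian_one_factorization (complete_multipartite (2 ^ v * d) (2 * d')) \<F>"
    by (rule abelian_one_factorization_even_number_of_parts) (use * in auto)
  then show "\<exists>\<F>. abelian_one_factorization (complete_multipartite m n) \<F>" using * by simp
next
  fix m n p :: nat
  assume *: "m = p \<and> n = 2 \<and> Factorial_Ring.prime p \<and> [p = 1] (mod 4)"
  then have "p mod 4 = 1" by (simp add: cong_def)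
  then have "odd p" by presburger
  then show "\<not> (\<exists>\<F>. abelian_one_factorization (complete_multipartite m n) \<F>)"
    using * no_abelian_one_factorization_prime[of p] by blast
next
  fix m n p v :: nat
  assume *: "m = p ^ v \<and> n = 2 \<and> Factorial_Ring.prime p \<and> [p = 1] (mod 4) \<and> v \<ge> 2"
  have p: "[p = 1] (mod 4)" "p > 1" using * prime_gt_1_nat by auto
  have "[p ^ (v - 1) = 1] (mod 4)" using cong_pow[OF p(1), of "v - 1"] by simp
  moreover have "p ^ (v - 1) > 1" using p(2) * by (intro one_less_power) auto
  ultimately have "\<exists>\<F>. abelian_one_factorization (complete_multipartite (p * p ^ (v - 1)) 2) \<F>"
    using abelian_one_factorization_product_1_mod_4[OF p] by blast
  moreover have "p * p ^ (v - 1) = m"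
    using * power_Suc[of p "v - 1"] by simp
  ultimately show "\<exists>\<F>. abelian_one_factorization (complete_multipartite m n) \<F>" using * by simp
next
  fix m n d :: nat
  assume "[m = 3] (mod 4) \<and> n = 2 * d \<and> odd d"
  then show "\<not> (\<exists>\<F>. abelian_one_factorization (complete_multipartite m n) \<F>)"
    using no_abelian_one_factorization_3_mod_4[of m d] by blast
qed

end
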